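(* Let $(a_n)_{n\ge0}$ be a sequence of positive reals, and consider the weight function $w_0(h,t)=a_{h+t}$, $w_1(h,t)=1$ on $\mathbb Z_+^2$, with $\mathcal P=\mathcal P(w)$. If $$\sum_{n=0}^\infty \frac{a_n}{(1+a_n)^2}=\infty,$$ then $\mathrm{ext}\,\mathcal P=\{P_\theta:\theta\in[0,\infty]\}$, and $\mathcal E:=\{\pi(P):P\in\mathrm{ext}\,\mathcal P\}$ equals $[0,1]$, this being the range of $\pi(P_\theta)=\frac{\theta}{a_0+\theta}$, $\theta\in[0,\infty]$ (with value $1$ at $\theta=\infty$).
   Context: Consider the lattice $\mathbb Z_+^2$ with directed edges $(h,t)\to(h+1,t)$ and $(h,t)\to(h,t+1)$, carrying strictly positive weights $w_1(h,t)$ and $w_0(h,t)$ respectively. A standard path starts at $(0,0)$ and moves along directed edges. The weight of a finite path is the product of the weights of its edges; $d(h,t)$ is the sum of the weights of all standard paths with endpoint $(h,t)$. $\mathcal P=\mathcal P(w)$ is the set of probability laws $P$ of random infinite standard paths $S=(S_n)_{n\ge 0}$, $S_n=(H_n,T_n)$, $H_n+T_n=n$, with the conditioning property: whenever $P(S_{h+t}=(h,t))>0$, given $S_{h+t}=(h,t)$ the conditional probability of each standard path with endpoint $(h,t)$ is the weight of that path divided by $d(h,t)$. $\mathcal P$ is convex; $\mathrm{ext}\,\mathcal P$ denotes its set of extreme points, and $\pi(P):=P(H_1=1)$. For $0<\theta<\infty$, $P_\theta\in\mathcal P$ is the law of $S$ under which the increments $S_{n+1}-S_n$, $n\ge0$,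 are independent and equal to $(1,0)$ with probability $\theta/(\theta+a_n)$ and to $(0,1)$ with probability $a_n/(\theta+a_n)$. $P_0$ is the law supported by the single path with $H_n=0$ for all $n$, and $P_\infty$ is the law supported by the single path with $T_n=0$ for all $n$. *)

theory Defs
  imports "HOL-Probability.Probability"
begin

definition lattice_edge :: "nat \<times> nat \<Rightarrow> nat \<times> nat \<Rightarrow> bool" where
  "lattice_edge x y \<longleftrightarrow> y = (fst x + 1, snd x) \<or> y = (fst x, snd x + 1)"

text \<open>Throughout, \<open>w1 h t\<close> is the weight of \<open>(h, t) \<rightarrow> (h + 1, t)\<close> and \<open>w0 h t\<close> the
  weight of \<open>(h, t) \<rightarrow> (h, t + 1)\<close>.\<close>

definition edge_weight ::
  "(nat \<Rightarrow> nat \<Rightarrow> real) \<Rightarrow> (nat \<Rightarrow> nat \<Rightarrow> real) \<Rightarrow> nat \<times> nat \<Rightarrow> nat \<times> nat \<Rightarrow> real" where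
  "edge_weight w1 w0 x y =
    (if y = (fst x + 1, snd x) then w1 (fst x) (snd x) else w0 (fst x) (snd x))"

text \<open>A finite path is the list of its vertices; the empty list is not a path.\<close>

definition standard_path :: "(nat \<times> nat) list \<Rightarrow> bool" where
  "standard_path p \<longleftrightarrow> p \<noteq> [] \<and> hd p = (0, 0) \<and> successively lattice_edge p"

definition path_weight ::
  "(nat \<Rightarrow> nat \<Rightarrow> real) \<Rightarrow> (nat \<Rightarrow> nat \<Rightarrow> real) \<Rightarrow> (nat \<times> nat) list \<Rightarrow> real" where
  "path_weight w1 w0 p = (\<Prod>i<length p - 1. edge_weight w1 w0 (p ! i) (p ! Suc i))"

definition total_weight ::
  "(nat \<Rightarrow> nat \<Rightarrow> real) \<Rightarrow> (nat \<Rightarrow> nat \<Rightarrow> real) \<Rightarrow> nat \<Rightarrow> nat \<Rightarrow> real" where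
  "total_weight w1 w0 h t = (\<Sum>p | standard_path p \<and> last p = (h, t). path_weight w1 w0 p)"

lemma standard_path_nth_sum:
  assumes "standard_path p" "i < length p"
  shows "fst (p ! i) + snd (p ! i) = i"
  using assms(2)
proof (induction i)
  case 0
  then show ?case using assms by (simp add: standard_path_def hd_conv_nth)
next
  case (Suc i)
  have "lattice_edge (p ! i) (p ! Suc i)"
    using assms(1) Suc.prems by (simp add: standard_path_def successively_conv_nth)
  then show ?case using Suc by (auto simp: lattice_edge_def)
qed

lemma finite_standard_paths: "finite {p. standard_path p \<and> last p = (h, t)}"
proof (rule finite_subset)
  show "finite {p. set p \<subseteq> {..h + t} \<times> {..h + t} \<and> length p = Suc (h + t)}"
    by (rule finite_lists_length_eq) auto
  show "{p. standard_path p \<and> last p = (h, t)} \<subseteq>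
    {p. set p \<subseteq> {..h + t} \<times> {..h + t} \<and> length p = Suc (h + t)}"
  proof safe
    fix p assume p: "standard_path p" "last p = (h, t)"
    have ne: "p \<noteq> []" using p by (simp add: standard_path_def)
    have "h + t = length p - 1"
      using standard_path_nth_sum[OF p(1), of "length p - 1"] p(2) ne
      by (simp add: last_conv_nth)
    then show len: "length p = Suc (h + t)" using ne by (cases p) auto
    fix x y assume "(x, y) \<in> set p"
    then obtain i where "i < length p" "p ! i = (x, y)" by (auto simp: in_set_conv_nth)
    with standard_path_nth_sum[OF p(1), of i] len show "x \<le> h + t" "y \<le> h + t" by auto
  qed
qed

definition infinite_paths :: "(nat \<Rightarrow> nat \<times> nat) set" where
  "infinite_paths = {s. s 0 = (0, 0) \<and> (\<forall>n. lattice_edge (s n) (s (Suc n)))}"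

text \<open>Only the \<open>\<sigma>\<close>-algebra of the following measure matters: it is the one generated by
  the coordinates.\<close>

definition path_space :: "(nat \<Rightarrow> nat \<times> nat) measure" where
  "path_space = restrict_space (\<Pi>\<^sub>M n\<in>UNIV. count_space UNIV) infinite_paths"

definition path_laws ::
  "(nat \<Rightarrow> nat \<Rightarrow> real) \<Rightarrow> (nat \<Rightarrow> nat \<Rightarrow> real) \<Rightarrow> (nat \<Rightarrow> nat \<times> nat) measure set" where
  "path_laws w1 w0 = {P. prob_space P \<and> sets P = sets path_space \<and>
    (\<forall>h t. \<P>(s in P. s (h + t) = (h, t)) > 0 \<longrightarrow>
      (\<forall>p. standard_path p \<and> last p = (h, t) \<longrightarrow>
        \<P>(s in P. map s [0..<Suc (h + t)] = p \<bar> s (h + t) = (h, t)) =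
          path_weight w1 w0 p / total_weight w1 w0 h t))}"

text \<open>Measures do not form a vector space in HOL, so the library's notion of an extreme
  point does not apply; convex combinations are taken setwise.\<close>

definition extreme_laws :: "'a measure set \<Rightarrow> 'a measure set" where
  "extreme_laws C = {P \<in> C. \<not> (\<exists>Q\<in>C. \<exists>R\<in>C. \<exists>u::real. Q \<noteq> R \<and> 0 < u \<and> u < 1 \<and>
    (\<forall>A\<in>sets P. measure P A = (1 - u) * measure Q A + u * measure R A))}"

definition first_step_prob :: "(nat \<Rightarrow> nat \<times> nat) measure \<Rightarrow> real" where
  "first_step_prob P = \<P>(s in P. fst (s 1) = 1)"

definition step :: "bool \<Rightarrow> nat \<times> nat" where
  "step b = (if b then (1, 0) else (0, 1))"

definition walk :: "(nat \<Rightarrow> bool) \<Rightarrow> nat \<Rightarrow> nat \<times> nat" where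
  "walk b n = (\<Sum>i<n. step (b i))"

definition indep_law :: "(nat \<Rightarrow> real) \<Rightarrow> real \<Rightarrow> (nat \<Rightarrow> nat \<times> nat) measure" where
  "indep_law a \<theta> =
    distr (\<Pi>\<^sub>M n\<in>UNIV. measure_pmf (bernoulli_pmf (\<theta> / (\<theta> + a n)))) path_space walk"

definition P_theta :: "(nat \<Rightarrow> real) \<Rightarrow> ennreal \<Rightarrow> (nat \<Rightarrow> nat \<times> nat) measure" where
  "P_theta a \<theta> =
    (if \<theta> = 0 then return path_space (\<lambda>n. (0, n))
     else if \<theta> = \<infinity> then return path_space (\<lambda>n. (n, 0))
     else indep_law a (enn2real \<theta>))"

text \<open>The next lemmas confirm that \<open>indep_law\<close> is the law under which the increments are
  independent with the prescribed distributions.\<close>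

lemma walk_in_infinite_paths: "walk b \<in> infinite_paths"
  by (auto simp: infinite_paths_def walk_def step_def lattice_edge_def zero_prod_def prod_eq_iff)

lemma walk_increment: "walk b (Suc n) - walk b n = step (b n)"
  by (simp add: walk_def prod_eq_iff)

lemma space_path_space: "space path_space = infinite_paths"
  by (simp add: path_space_def space_restrict_space space_PiM)

lemma measurable_walk:
  assumes "\<And>n. sets (M n) = UNIV"
  shows "walk \<in> measurable (\<Pi>\<^sub>M n\<in>UNIV. M n) path_space"
proof -
  have M: "(\<lambda>b. b i) \<in> measurable (\<Pi>\<^sub>M n\<in>UNIV. M n) (count_space UNIV)" for i
  proof -
    have "sets (M i) = sets (count_space UNIV)" using assms by simp
    from measurable_cong_sets[OF refl this, of "Pi\<^sub>M UNIV M"] show ?thesis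
      using measurable_component_singleton[of i UNIV M] by blast
  qed
  have "(\<lambda>b. walk b n) \<in> measurable (\<Pi>\<^sub>M n\<in>UNIV. M n) (count_space UNIV)" for n
  proof (induction n)
    case 0
    then show ?case by (simp add: walk_def)
  next
    case (Suc n)
    have "(\<lambda>b. (\<lambda>(x, y). x + step y) (walk b n, b n)) \<in>
        measurable (\<Pi>\<^sub>M n\<in>UNIV. M n) (count_space UNIV)"
      by (rule measurable_compose[OF measurable_Pair[OF Suc M]])
        (simp add: pair_measure_countable)
    then show ?case by (simp add: walk_def)
  qed
  then have "walk \<in> measurable (\<Pi>\<^sub>M n\<in>UNIV. M n) (\<Pi>\<^sub>M n\<in>UNIV. count_space UNIV)"
    by (intro measurable_PiM_single') auto
  then show ?thesis
    unfolding path_space_def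
    by (intro measurable_restrict_space2) (auto simp: walk_in_infinite_paths)
qed

lemma prob_space_indep_law: "prob_space (indep_law a \<theta>)"
  unfolding indep_law_def
  by (intro prob_space.prob_space_distr prob_space_PiM prob_space_measure_pmf measurable_walk) simp

lemma measurable_increment:
  "(\<lambda>s. s (Suc n) - s n) \<in> measurable path_space (count_space UNIV)"
proof -
  have "(\<lambda>s. (\<lambda>(x, y). x - y) (s (Suc n), s n)) \<in>
      measurable (\<Pi>\<^sub>M n\<in>UNIV. count_space UNIV :: (nat \<times> nat) measure) (count_space UNIV)"
    by (rule measurable_compose[OF measurable_Pair[OF
        measurable_component_singleton measurable_component_singleton]])
      (simp_all add: pair_measure_countable)
  then show ?thesis unfolding path_space_def by (intro measurable_restrict_space1) simp
qed

lemma indep_law_increment: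
  "distr (indep_law a \<theta>) (count_space UNIV) (\<lambda>s. s (Suc n) - s n) =
    distr (measure_pmf (bernoulli_pmf (\<theta> / (\<theta> + a n)))) (count_space UNIV) step"
proof -
  let ?B = "\<lambda>n. measure_pmf (bernoulli_pmf (\<theta> / (\<theta> + a n)))"
  have "distr (indep_law a \<theta>) (count_space UNIV) (\<lambda>s. s (Suc n) - s n) =
      distr (Pi\<^sub>M UNIV ?B) (count_space UNIV) (\<lambda>b. step (b n))"
    unfolding indep_law_def
    by (subst distr_distr[OF measurable_increment measurable_walk])
      (simp_all add: comp_def walk_increment)
  also have "\<dots> = distr (distr (Pi\<^sub>M UNIV ?B) (?B n) (\<lambda>b. b n)) (count_space UNIV) step"
    by (subst distr_distr) (auto simp: comp_def)
  also have "distr (Pi\<^sub>M UNIV ?B) (?B n) (\<lambda>b. b n) = ?B n"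
    by (rule distr_PiM_component) (auto intro: prob_space_measure_pmf)
  finally show ?thesis .
qed

lemma indep_law_increment_prob:
  assumes "0 < \<theta>" "\<And>n. 0 < a n"
  shows "\<P>(s in indep_law a \<theta>. s (Suc n) - s n = (1, 0)) = \<theta> / (\<theta> + a n)"
    and "\<P>(s in indep_law a \<theta>. s (Suc n) - s n = (0, 1)) = a n / (\<theta> + a n)"
proof -
  let ?q = "\<theta> / (\<theta> + a n)"
  have pos: "0 < \<theta> + a n" using assms(1) assms(2)[of n] by simp
  have q: "0 \<le> ?q" "?q \<le> 1" "1 - ?q = a n / (\<theta> + a n)"
    using assms(1) assms(2)[of n] pos by (simp_all add: field_simps)
  have m: "(\<lambda>s. s (Suc n) - s n) \<in> measurable (indep_law a \<theta>) (count_space UNIV)"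
    using measurable_increment by (simp add: indep_law_def)
  have *: "\<P>(s in indep_law a \<theta>. s (Suc n) - s n = x) =
      measure (bernoulli_pmf ?q) (step -` {x})" for x
  proof -
    have "\<P>(s in indep_law a \<theta>. s (Suc n) - s n = x) =
        measure (distr (indep_law a \<theta>) (count_space UNIV) (\<lambda>s. s (Suc n) - s n)) {x}"
      using m by (subst measure_distr) (auto intro!: arg_cong[where f = "measure _"])
    also have "\<dots> = measure (bernoulli_pmf ?q) (step -` {x})"
      unfolding indep_law_increment by (subst measure_distr) auto
    finally show ?thesis .
  qed
  have v: "step -` {(1, 0)} = {True}" "step -` {(0, 1)} = {False}"
    by (auto simp: step_def split: if_splits)
  show "\<P>(s in indep_law a \<theta>. s (Suc n) - s n = (1, 0)) = \<theta> / (\<theta> + a n)"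
    unfolding * v using q by (simp add: measure_pmf_single)
  show "\<P>(s in indep_law a \<theta>. s (Suc n) - s n = (0, 1)) = a n / (\<theta> + a n)"
    unfolding * v using q by (simp add: measure_pmf_single)
qed

lemma indep_law_indep_increments:
  "prob_space.indep_vars (indep_law a \<theta>) (\<lambda>_. count_space UNIV) (\<lambda>n s. s (Suc n) - s n) UNIV"
proof -
  let ?B = "\<lambda>n. measure_pmf (bernoulli_pmf (\<theta> / (\<theta> + a n)))"
  let ?C = "\<lambda>n::nat. count_space (UNIV :: (nat \<times> nat) set)"
  have PB: "prob_space (Pi\<^sub>M UNIV ?B)"
    by (intro prob_space_PiM prob_space_measure_pmf)
  have mc: "(\<lambda>b. b n) \<in> measurable (Pi\<^sub>M UNIV ?B) (?B n)" for n
    by (rule measurable_component_singleton) simp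
  have ms: "(\<lambda>b. step (b n)) \<in> measurable (Pi\<^sub>M UNIV ?B) (count_space UNIV)" for n
    by (rule measurable_compose[OF mc]) simp
  have comp: "distr (Pi\<^sub>M UNIV ?B) (?B n) (\<lambda>b. b n) = ?B n" for n
    by (rule distr_PiM_component) (auto intro: prob_space_measure_pmf)
  have dstep: "distr (Pi\<^sub>M UNIV ?B) (?C n) (\<lambda>b. step (b n)) = distr (?B n) (?C n) step" for n
    by (subst (2) comp[symmetric], subst distr_distr) (auto simp: comp_def)
  have coords: "prob_space.indep_vars (Pi\<^sub>M UNIV ?B) ?B (\<lambda>n b. b n) UNIV"
    by (subst prob_space.indep_vars_iff_distr_eq_PiM[OF PB])
      (use mc in \<open>simp_all add: comp distr_id restrict_UNIV\<close>)
  have steps: "prob_space.indep_vars (Pi\<^sub>M UNIV ?B) ?C (\<lambda>n b. step (b n)) UNIV"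
    by (rule prob_space.indep_vars_compose2[OF PB coords]) simp
  have m: "(\<lambda>s. s (Suc n) - s n) \<in> measurable (indep_law a \<theta>) (count_space UNIV)" for n
    using measurable_increment by (simp add: indep_law_def)
  have m': "(\<lambda>s. \<lambda>n\<in>UNIV. s (Suc n) - s n) \<in> measurable path_space (Pi\<^sub>M UNIV ?C)"
    by (intro measurable_restrict measurable_increment)
  have "distr (indep_law a \<theta>) (Pi\<^sub>M UNIV ?C) (\<lambda>s. \<lambda>n\<in>UNIV. s (Suc n) - s n) =
      distr (Pi\<^sub>M UNIV ?B) (Pi\<^sub>M UNIV ?C) (\<lambda>b. \<lambda>n\<in>UNIV. step (b n))"
    unfolding indep_law_def
    by (subst distr_distr[OF m' measurable_walk])
      (simp_all add: comp_def walk_increment)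
  also have "\<dots> = Pi\<^sub>M UNIV (\<lambda>n. distr (Pi\<^sub>M UNIV ?B) (?C n) (\<lambda>b. step (b n)))"
    using steps
    by (subst (asm) prob_space.indep_vars_iff_distr_eq_PiM[OF PB]) (auto intro: ms)
  also have "\<dots> = Pi\<^sub>M UNIV (\<lambda>n. distr (?B n) (?C n) step)"
    by (simp add: dstep)
  finally show ?thesis
    by (subst prob_space.indep_vars_iff_distr_eq_PiM[OF prob_space_indep_law])
      (use m in \<open>simp_all add: indep_law_increment\<close>)
qed

end

(* A law P in the class is determined by a nonnegative harmonic function f, namely
   P(path) = weight(path) * f(endpoint), and extreme laws correspond to extreme f.

   Take a block J of late times and put w_j = a_j/(1+a_j) if step j is horizontal and w_j = 0
   otherwise, u_j = 1/(1+a_j) if step j is vertical and u_j = 0 otherwise.  Always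
   sum_J (w_j + u_j) >= V = sum_J a_j/(1+a_j)^2, which can be made arbitrarily large.  Let
   Y = sum_J w_j / sum_J (w_j + u_j).  Swapping an early step with step j in J changes Y by O(1/V)
   and multiplies path weights by an explicit factor; summed over j this says that f_Y, the function
   representing the measure Y dP, satisfies (f - f_Y)(h+1,t) = f_Y(h,t+1) up to O(1/V).

   If f is extreme, a limit of the functions f_Y is y f for some y in [0,1], so
   (1-y) f(h+1,t) = y f(h,t+1), and this is the harmonic function of P_theta for
   theta = y/(1-y).  Conversely, the same relations for Y and Y^2 show that under P_theta the
   variance of Y tends to 0, with Y close to theta/(1+theta).  Hence f_Y is close to
   theta/(1+theta) f for every law dominated by a multiple of P_theta, and such a law is P_theta. *)

theory Submission
  imports Defs "HOL-Complex_Analysis.Great_Picard"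
begin

section \<open>Path laws and harmonic functions\<close>

text \<open>The swap compares a continuation that starts at (h+1,t) and is vertical at time j with
  the one that starts at (h,t+1), is horizontal at j and otherwise agrees. Both end at the same
  vertex, and the first has the additional factor a_j. Masses in ratio a_j : 1 for horizontal and
  vertical steps therefore make the two sums match term by term, whatever the value of f at the
  endpoint. The denominator 1+a_j keeps each mass at most 1, so that one swap moves the total by at
  most 1, and keeps both masses above a_j/(1+a_j)^2. Hence the total is at least V for every pattern
  of steps, not merely on average. This is the point of dividing by a random total: the error O(1/V)
  needs no probabilistic estimate and is uniform over all laws. It is not known beforehand that Y
  converges along a path. All blocks therefore end at a finite level, f_Y is a finite sum over
  continuations, and limits come from compactness when f is extreme and from a second moment for
  P_theta.\<close>

lemma standard_path_snoc:
  "p \<noteq> [] \<Longrightarrow> standard_path (p @ [v]) \<longleftrightarrow> standard_path p \<and> lattice_edge (last p) v"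
  by (auto simp: standard_path_def successively_append_iff)

lemma standard_path_singleton: "standard_path [v] \<longleftrightarrow> v = (0, 0)"
  by (simp add: standard_path_def)

text \<open>Paths grow at their end, because weights, cylinders and harmonicity all refer to the
  last vertex.\<close>

lemma standard_path_induct [consumes 1, case_names singleton snoc]:
  assumes "standard_path p" "P [(0, 0)]"
    "\<And>p v. standard_path p \<Longrightarrow> P p \<Longrightarrow> lattice_edge (last p) v \<Longrightarrow> P (p @ [v])"
  shows "P p"
  using assms(1)
proof (induction p rule: rev_induct)
  case Nil
  then show ?case by (simp add: standard_path_def)
next
  case (snoc v p)
  then show ?case
    using assms(2,3) by (cases "p = []") (auto simp: standard_path_singleton standard_path_snoc)
qed

lemma standard_path_nonempty: "standard_path p \<Longrightarrow> p \<noteq> []"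
  by (simp add: standard_path_def)

lemma length_standard_path:
  assumes "standard_path p"
  shows "length p = Suc (fst (last p) + snd (last p))"
proof -
  have "p \<noteq> []" by (rule standard_path_nonempty[OF assms])
  then show ?thesis
    using standard_path_nth_sum[OF assms, of "length p - 1"] by (simp add: last_conv_nth)
qed

lemma exists_standard_path: "\<exists>p. standard_path p \<and> last p = (h, t)"
proof (induction h arbitrary: t)
  case 0
  show ?case
  proof (induction t)
    case 0
    show ?case by (intro exI[of _ "[(0, 0)]"]) (simp add: standard_path_singleton)
  next
    case (Suc t)
    then obtain p where "standard_path p" "last p = (0, t)" by blast
    then show ?case
      by (intro exI[of _ "p @ [(0, Suc t)]"])
        (simp add: standard_path_snoc standard_path_nonempty lattice_edge_def)
  qed
next
  case (Suc h)
  then obtain p where "standard_path p" "last p = (h, t)" by blast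
  then show ?case
    by (intro exI[of _ "p @ [(Suc h, t)]"])
      (simp add: standard_path_snoc standard_path_nonempty lattice_edge_def)
qed

lemma path_weight_singleton: "path_weight w1 w0 [v] = 1"
  by (simp add: path_weight_def)

lemma path_weight_snoc:
  assumes "p \<noteq> []"
  shows "path_weight w1 w0 (p @ [v]) = path_weight w1 w0 p * edge_weight w1 w0 (last p) v"
proof -
  obtain n where n: "length p = Suc n" using assms by (cases p) auto
  then have "last p = p ! n" using assms by (simp add: last_conv_nth)
  then show ?thesis using n by (simp add: path_weight_def nth_append)
qed

section \<open>Cylinder sets and the sigma-algebra of the coordinates\<close>

definition cylinder :: "(nat \<times> nat) list \<Rightarrow> (nat \<Rightarrow> nat \<times> nat) set" where
  "cylinder p = {s \<in> infinite_paths. map s [0..<length p] = p}"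

lemma cylinder_snoc: "s \<in> cylinder (p @ [v]) \<longleftrightarrow> s \<in> cylinder p \<and> s (length p) = v"
  by (auto simp: cylinder_def)

lemma cylinder_singleton: "cylinder [(0, 0)] = infinite_paths"
  by (auto simp: cylinder_def infinite_paths_def)

lemma cylinder_last: "s \<in> cylinder p \<Longrightarrow> standard_path p \<Longrightarrow> s (fst (last p) + snd (last p)) = last p"
proof -
  assume s: "s \<in> cylinder p" and p: "standard_path p"
  obtain q where q: "p = q @ [last p]"
    using standard_path_nonempty[OF p] by (metis append_butlast_last_id)
  then have "s (length q) = last p" using s cylinder_snoc[of s q "last p"] by simp
  moreover have "length q = fst (last p) + snd (last p)"
    using length_standard_path[OF p] arg_cong[OF q, of length] by simp
  ultimately show ?thesis by simp
qed

lemma infinite_path_standard: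
  assumes "s \<in> infinite_paths"
  shows "standard_path (map s [0..<Suc n])" "s \<in> cylinder (map s [0..<Suc n])"
proof -
  show "standard_path (map s [0..<Suc n])"
  proof (induction n)
    case 0
    then show ?case using assms by (simp add: standard_path_singleton infinite_paths_def)
  next
    case (Suc n)
    have "map s [0..<Suc (Suc n)] = map s [0..<Suc n] @ [s (Suc n)]" by simp
    moreover have "last (map s [0..<Suc n]) = s n" by simp
    moreover have "map s [0..<Suc n] \<noteq> []" by simp
    moreover have "lattice_edge (s n) (s (Suc n))" using assms by (simp add: infinite_paths_def)
    ultimately show ?case using Suc standard_path_snoc by metis
  qed
  show "s \<in> cylinder (map s [0..<Suc n])" using assms by (simp add: cylinder_def)
qed

lemma infinite_path_level:
  assumes "s \<in> infinite_paths"
  shows "fst (s n) + snd (s n) = n"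
  using length_standard_path[OF infinite_path_standard(1)[OF assms, of n]] by simp

lemma measurable_coordinate: "(\<lambda>s. s n) \<in> measurable path_space (count_space UNIV)"
  unfolding path_space_def by (intro measurable_restrict_space1 measurable_component_singleton) simp

lemma coordinate_sets: "{s \<in> infinite_paths. s n = v} \<in> sets path_space"
  using measurable_sets[OF measurable_coordinate, of "{v}" n]
  by (simp add: space_path_space vimage_def Int_def conj_commute)

lemma cylinder_sets: "standard_path p \<Longrightarrow> cylinder p \<in> sets path_space"
proof (induction p rule: standard_path_induct)
  case singleton
  then show ?case using sets.top[of path_space] by (simp add: cylinder_singleton space_path_space)
next
  case (snoc p v)
  have "cylinder (p @ [v]) = cylinder p \<inter> {s \<in> infinite_paths. s (length p) = v}"
    by (auto simp: cylinder_snoc) (simp add: cylinder_def)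
  then show ?case using sets.Int[OF snoc.IH coordinate_sets] by simp
qed

lemma coordinate_eq_cylinders:
  "{s \<in> infinite_paths. s (h + t) = (h, t)} = (\<Union>p\<in>{p. standard_path p \<and> last p = (h, t)}. cylinder p)"
proof (intro set_eqI iffI)
  fix s assume s: "s \<in> {s \<in> infinite_paths. s (h + t) = (h, t)}"
  then have "last (map s [0..<Suc (h + t)]) = (h, t)" by simp
  then show "s \<in> (\<Union>p\<in>{p. standard_path p \<and> last p = (h, t)}. cylinder p)"
    using infinite_path_standard[of s "h + t"] s by blast
next
  fix s assume "s \<in> (\<Union>p\<in>{p. standard_path p \<and> last p = (h, t)}. cylinder p)"
  then obtain p where p: "standard_path p" "last p = (h, t)" "s \<in> cylinder p" by blast
  then show "s \<in> {s \<in> infinite_paths. s (h + t) = (h, t)}"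
    using cylinder_last[of s p] by (simp add: cylinder_def)
qed

lemma cylinder_inter:
  assumes "length p \<le> length q"
  shows "cylinder p \<inter> cylinder q = (if take (length p) q = p then cylinder q else {})"
proof -
  have "take (length p) (map s [0..<length q]) = map s [0..<length p]" for s :: "nat \<Rightarrow> nat \<times> nat"
    using assms by (simp add: take_map)
  then show ?thesis by (auto simp: cylinder_def) metis+
qed

lemma cylinder_disjoint: "length p = length q \<Longrightarrow> p \<noteq> q \<Longrightarrow> cylinder p \<inter> cylinder q = {}"
  by (auto simp: cylinder_def)

text \<open>The empty set is added for closure under intersection: two cylinders are disjoint unless
  one of the paths extends the other.\<close>

abbreviation cylinders :: "(nat \<Rightarrow> nat \<times> nat) set set" where
  "cylinders \<equiv> insert {} (cylinder ` {p. standard_path p})"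

lemma Int_stable_cylinders: "Int_stable cylinders"
proof (rule Int_stableI)
  have *: "cylinder p \<inter> cylinder q \<in> cylinders"
    if "standard_path p" "standard_path q" "length p \<le> length q" for p q
    using that cylinder_inter[OF that(3)] by auto
  fix A B assume "A \<in> cylinders" "B \<in> cylinders"
  then consider "A \<inter> B = {}" | p q where "A = cylinder p" "B = cylinder q" "standard_path p" "standard_path q"
    by auto
  then show "A \<inter> B \<in> cylinders"
  proof cases
    case 2
    show ?thesis
    proof (cases "length p \<le> length q")
      case True
      then show ?thesis unfolding 2 using *[of p q] 2 by blast
    next
      case False
      then have "cylinder q \<inter> cylinder p \<in> cylinders" using *[of q p] 2 by simp
      then show ?thesis unfolding 2 by (simp only: Int_commute)
    qed
  qed blast
qed

lemma cylinders_closed: "cylinders \<subseteq> Pow infinite_paths"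
  by (auto simp: cylinder_def)

text \<open>The event \<open>s n = v\<close> is a finite union of cylinders if \<open>v\<close> lies
  on level \<open>n\<close>, and empty otherwise. Hence the coordinates are measurable for the
  sigma-algebra of the cylinders.\<close>

lemma sets_path_space_cylinders: "sets path_space = sigma_sets infinite_paths cylinders"
proof
  show "sigma_sets infinite_paths cylinders \<subseteq> sets path_space"
    unfolding space_path_space[symmetric]
    by (rule sets.sigma_sets_subset) (auto intro: cylinder_sets)
  let ?M = "sigma infinite_paths cylinders"
  have sp: "space ?M = infinite_paths" using cylinders_closed by (rule space_measure_of)
  have st: "sets ?M = sigma_sets infinite_paths cylinders"
    using cylinders_closed by (rule sets_measure_of)
  have "(\<lambda>s. s n) \<in> measurable ?M (count_space UNIV)" for n
  proof (subst measurable_count_space_eq2_countable, intro conjI ballI)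
    fix v :: "nat \<times> nat"
    show "(\<lambda>s. s n) -` {v} \<inter> space ?M \<in> sets ?M"
    proof (cases "n = fst v + snd v")
      case True
      then have "(\<lambda>s. s n) -` {v} \<inter> space ?M =
          (\<Union>p\<in>{p. standard_path p \<and> last p = (fst v, snd v)}. cylinder p)"
        unfolding coordinate_eq_cylinders[symmetric] sp by auto
      also have "\<dots> \<in> sets ?M"
        unfolding st
        by (intro sigma_sets_UNION countable_finite finite_imageI finite_standard_paths)
          (auto intro: sigma_sets.Basic)
      finally show ?thesis .
    next
      case False
      then have "(\<lambda>s. s n) -` {v} \<inter> space ?M = {}"
        unfolding sp using infinite_path_level[of _ n] by force
      then show ?thesis by simp
    qed
  qed auto
  then have "(\<lambda>s. s) \<in> measurable ?M (\<Pi>\<^sub>M n\<in>UNIV. count_space UNIV)"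
    by (intro measurable_PiM_single') auto
  then have "(\<lambda>s. s) \<in> measurable ?M path_space"
    unfolding path_space_def by (intro measurable_restrict_space2) (auto simp: sp)
  then show "sets path_space \<subseteq> sigma_sets infinite_paths cylinders"
    using measurable_sets[of "\<lambda>s. s" ?M path_space] sets.sets_into_space[of _ path_space]
    unfolding st sp space_path_space by (force simp: Int_absorb2)
qed

text \<open>A Dynkin argument: both sides are countably additive in \<open>A\<close>, and they agree
  on complements because the coefficients sum to 1. The case \<open>u = 0\<close> says that cylinder
  probabilities determine a law.\<close>

lemma law_combination:
  fixes P Q R :: "(nat \<Rightarrow> nat \<times> nat) measure" and u :: real
  assumes P: "prob_space P" "sets P = sets path_space"
    and Q: "prob_space Q" "sets Q = sets path_space"
    and R: "prob_space R" "sets R = sets path_space"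
    and cyl: "\<And>p. standard_path p \<Longrightarrow>
      measure P (cylinder p) = (1 - u) * measure Q (cylinder p) + u * measure R (cylinder p)"
    and A: "A \<in> sets path_space"
  shows "measure P A = (1 - u) * measure Q A + u * measure R A"
proof -
  interpret P: prob_space P by (rule P(1))
  interpret Q: prob_space Q by (rule Q(1))
  interpret R: prob_space R by (rule R(1))
  have sp: "space P = infinite_paths" "space Q = infinite_paths" "space R = infinite_paths"
    using P(2) Q(2) R(2) sets_eq_imp_space_eq space_path_space by metis+
  note st = P(2) Q(2) R(2) sets_path_space_cylinders
  from A have "A \<in> sigma_sets infinite_paths cylinders" by (simp add: sets_path_space_cylinders)
  with Int_stable_cylinders cylinders_closed show ?thesis
  proof (induction rule: sigma_sets_induct_disjoint)
    case (basic A)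
    then show ?case using cyl by auto
  next
    case empty
    show ?case by simp
  next
    case (compl A)
    then have eq: "measure P (infinite_paths - A) = 1 - measure P A"
      "measure Q (infinite_paths - A) = 1 - measure Q A"
      "measure R (infinite_paths - A) = 1 - measure R A"
      using P.prob_compl[of A] Q.prob_compl[of A] R.prob_compl[of A] unfolding sp st by auto
    show ?case unfolding eq compl.IH by (simp add: algebra_simps)
  next
    case (union A)
    have "(\<lambda>i. measure P (A i)) sums measure P (\<Union>i. A i)"
      "(\<lambda>i. measure Q (A i)) sums measure Q (\<Union>i. A i)"
      "(\<lambda>i. measure R (A i)) sums measure R (\<Union>i. A i)"
      using union by (intro P.finite_measure_UNION Q.finite_measure_UNION R.finite_measure_UNION; simp add: st)+
    note s = this
    have "(\<lambda>i. measure P (A i)) sums ((1 - u) * measure Q (\<Union>i. A i) + u * measure R (\<Union>i. A i))"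
      unfolding union.IH by (intro sums_add sums_mult s)
    with s(1) show ?case by (rule sums_unique2)
  qed
qed

section \<open>Laws given by path weight times a function of the endpoint\<close>

definition represents ::
  "(nat \<Rightarrow> nat \<Rightarrow> real) \<Rightarrow> (nat \<Rightarrow> nat \<Rightarrow> real) \<Rightarrow> (nat \<Rightarrow> nat \<times> nat) measure \<Rightarrow>
    (nat \<Rightarrow> nat \<Rightarrow> real) \<Rightarrow> bool" where
  "represents w1 w0 P f \<longleftrightarrow> prob_space P \<and> sets P = sets path_space \<and>
    (\<forall>p. standard_path p \<longrightarrow>
      measure P (cylinder p) = path_weight w1 w0 p * f (fst (last p)) (snd (last p)))"

lemma represents_unique:
  assumes "represents w1 w0 P f" "represents w1 w0 Q f"
  shows "P = Q"
proof (rule measure_eqI)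
  show "sets P = sets Q" using assms by (simp add: represents_def)
  fix A assume A: "A \<in> sets P"
  have P: "prob_space P" "sets P = sets path_space" and Q: "prob_space Q" "sets Q = sets path_space"
    and eq: "\<And>p. standard_path p \<Longrightarrow> measure P (cylinder p) = measure Q (cylinder p)"
    using assms by (simp_all add: represents_def)
  have "measure P A = (1 - 0) * measure Q A + 0 * measure Q A"
    by (rule law_combination[OF P Q Q]) (use A P(2) eq in simp_all)
  moreover have "finite_measure P" "finite_measure Q"
    using assms by (auto simp: represents_def prob_space.finite_measure)
  ultimately show "emeasure P A = emeasure Q A"
    by (simp add: finite_measure.emeasure_eq_measure)
qed

section \<open>Paths driven by independent coins\<close>

lemma measure_PiM_pmf:
  fixes B :: "'i \<Rightarrow> 'a pmf"
  assumes "finite J"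
  shows "measure (\<Pi>\<^sub>M i\<in>UNIV. measure_pmf (B i)) {\<omega>. \<forall>j\<in>J. \<omega> j = d j} = (\<Prod>j\<in>J. pmf (B j) (d j))"
proof -
  interpret product_prob_space "\<lambda>i. measure_pmf (B i)" UNIV
    by (intro product_prob_spaceI prob_space_measure_pmf)
  have "{\<omega>. \<forall>j\<in>J. \<omega> j = d j} = {\<omega> \<in> space (\<Pi>\<^sub>M i\<in>UNIV. measure_pmf (B i)). \<forall>j\<in>J. \<omega> j \<in> {d j}}"
    by (auto simp: space_PiM)
  also have "emeasure (\<Pi>\<^sub>M i\<in>UNIV. measure_pmf (B i)) \<dots> = (\<Prod>j\<in>J. emeasure (measure_pmf (B j)) {d j})"
    using assms by (intro emeasure_PiM_Collect) auto
  also have "\<dots> = ennreal (\<Prod>j\<in>J. pmf (B j) (d j))"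
    by (simp add: emeasure_pmf_single prod_ennreal)
  finally show ?thesis by (simp add: measure_def prod_nonneg)
qed

text \<open>The path flips, at each vertex it visits, the coin attached to that vertex; as the vertices
  of a path are distinct, independent coins make it a Markov chain.\<close>

primrec coin_path :: "(nat \<times> nat \<Rightarrow> bool) \<Rightarrow> nat \<Rightarrow> nat \<times> nat" where
  "coin_path \<omega> 0 = (0, 0)"
| "coin_path \<omega> (Suc n) = coin_path \<omega> n + step (\<omega> (coin_path \<omega> n))"

lemma coin_path_infinite: "coin_path \<omega> \<in> infinite_paths"
  by (auto simp: infinite_paths_def step_def lattice_edge_def prod_eq_iff)

definition turns_right :: "(nat \<times> nat) list \<Rightarrow> nat \<Rightarrow> bool" where
  "turns_right p i \<longleftrightarrow> fst (p ! Suc i) \<noteq> fst (p ! i)"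

lemma turns_right_append: "Suc i < length p \<Longrightarrow> turns_right (p @ q) i = turns_right p i"
  by (simp add: turns_right_def nth_append)

text \<open>Only the coins at the vertices of \<open>p\<close> before the last one are inspected, so
  this is a finite product event.\<close>

lemma coin_path_cylinder:
  assumes "standard_path p"
  shows "coin_path \<omega> \<in> cylinder p \<longleftrightarrow> (\<forall>i<length p - 1. \<omega> (p ! i) = turns_right p i)"
  using assms
proof (induction p rule: standard_path_induct)
  case singleton
  then show ?case by (simp add: cylinder_singleton coin_path_infinite)
next
  case (snoc p v)
  obtain n where n: "length p = Suc n"
    using standard_path_nonempty[OF snoc.hyps(1)] by (cases p) auto
  have last: "last p = p ! n"
    using n standard_path_nonempty[OF snoc.hyps(1)] by (simp add: last_conv_nth)
  have tr: "turns_right (p @ [v]) n \<longleftrightarrow> fst v \<noteq> fst (p ! n)"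
    using n by (simp add: turns_right_def nth_append)
  have "coin_path \<omega> (Suc n) = v \<longleftrightarrow> \<omega> (p ! n) = turns_right (p @ [v]) n"
    if "coin_path \<omega> \<in> cylinder p"
  proof -
    obtain x y where xy: "p ! n = (x, y)" by fastforce
    have "coin_path \<omega> n = (x, y)"
      unfolding xy[symmetric] using cylinder_last[OF that snoc.hyps(1)] length_standard_path[OF snoc.hyps(1)] n last by simp
    then have c: "coin_path \<omega> (Suc n) = (if \<omega> (x, y) then (Suc x, y) else (x, Suc y))"
      by (simp add: step_def)
    have "v = (Suc x, y) \<or> v = (x, Suc y)"
      using snoc.hyps(2) last xy by (simp add: lattice_edge_def)
    then show ?thesis
      unfolding tr xy c by (cases "\<omega> (x, y)") auto
  qed
  moreover have "(\<forall>i<n. \<omega> (p ! i) = turns_right p i) \<longleftrightarrow>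
      (\<forall>i<n. \<omega> ((p @ [v]) ! i) = turns_right (p @ [v]) i)"
    using n by (auto simp: nth_append turns_right_append)
  moreover have "(p @ [v]) ! n = p ! n" using n by (simp add: nth_append)
  ultimately show ?case
    unfolding cylinder_snoc snoc.IH using n by (auto simp: less_Suc_eq)
qed

section \<open>The affine correspondence between path laws and normalised harmonic functions\<close>

definition harmonic ::
  "(nat \<Rightarrow> nat \<Rightarrow> real) \<Rightarrow> (nat \<Rightarrow> nat \<Rightarrow> real) \<Rightarrow> (nat \<Rightarrow> nat \<Rightarrow> real) \<Rightarrow> bool" where
  "harmonic w1 w0 f \<longleftrightarrow> (\<forall>h t. 0 \<le> f h t \<and>
    f h t = w1 h t * f (Suc h) t + w0 h t * f h (Suc t))"

definition extreme_harmonic ::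
  "(nat \<Rightarrow> nat \<Rightarrow> real) \<Rightarrow> (nat \<Rightarrow> nat \<Rightarrow> real) \<Rightarrow> (nat \<Rightarrow> nat \<Rightarrow> real) \<Rightarrow> bool" where
  "extreme_harmonic w1 w0 f \<longleftrightarrow> (\<forall>g k u. harmonic w1 w0 g \<and> g 0 0 = 1 \<and> harmonic w1 w0 k \<and>
    k 0 0 = 1 \<and> 0 < u \<and> u < 1 \<and> (\<forall>h t. f h t = (1 - u) * g h t + u * k h t) \<longrightarrow> g = k)"

lemma extreme_harmonicD:
  assumes "extreme_harmonic w1 w0 f" "harmonic w1 w0 g" "g 0 0 = 1" "harmonic w1 w0 k" "k 0 0 = 1"
    "0 < u" "u < 1" "\<And>h t. f h t = (1 - u) * g h t + u * k h t"
  shows "g = k"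
  using assms unfolding extreme_harmonic_def by blast

locale positive_weights =
  fixes w1 w0 :: "nat \<Rightarrow> nat \<Rightarrow> real"
  assumes w1_pos: "0 < w1 h t" and w0_pos: "0 < w0 h t"
begin

lemma edge_weight_pos: "0 < edge_weight w1 w0 x y"
  by (simp add: edge_weight_def w1_pos w0_pos)

lemma path_weight_pos: "0 < path_weight w1 w0 p"
  unfolding path_weight_def by (intro prod_pos edge_weight_pos)

lemma harmonic_nonneg: "harmonic w1 w0 f \<Longrightarrow> 0 \<le> f h t"
  unfolding harmonic_def by blast

lemma harmonic_step:
  "harmonic w1 w0 f \<Longrightarrow> f h t = w1 h t * f (Suc h) t + w0 h t * f h (Suc t)"
  unfolding harmonic_def by blast

lemma represents_coordinate:
  assumes "represents w1 w0 P f"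
  shows "\<P>(s in P. s (h + t) = (h, t)) = total_weight w1 w0 h t * f h t"
proof -
  have P: "prob_space P" "sets P = sets path_space"
    and cyl: "\<And>p. standard_path p \<Longrightarrow>
      measure P (cylinder p) = path_weight w1 w0 p * f (fst (last p)) (snd (last p))"
    using assms by (auto simp: represents_def)
  interpret prob_space P by (rule P(1))
  have sp: "space P = infinite_paths" using P(2) sets_eq_imp_space_eq space_path_space by metis
  let ?I = "{p. standard_path p \<and> last p = (h, t)}"
  have "measure P (\<Union>p\<in>?I. cylinder p) = (\<Sum>p\<in>?I. measure P (cylinder p))"
  proof (rule finite_measure_finite_Union[OF finite_standard_paths])
    show "cylinder ` ?I \<subseteq> sets P" using cylinder_sets P(2) by auto
    show "disjoint_family_on cylinder ?I"
      unfolding disjoint_family_on_def using cylinder_disjoint length_standard_path by auto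
  qed
  also have "\<dots> = total_weight w1 w0 h t * f h t"
    unfolding total_weight_def sum_distrib_right by (intro sum.cong) (auto simp: cyl)
  finally show ?thesis unfolding sp coordinate_eq_cylinders .
qed

lemma represents_imp_law:
  assumes "represents w1 w0 P f"
  shows "P \<in> path_laws w1 w0"
proof -
  have P: "prob_space P" "sets P = sets path_space"
    and cyl: "\<And>p. standard_path p \<Longrightarrow>
      measure P (cylinder p) = path_weight w1 w0 p * f (fst (last p)) (snd (last p))"
    using assms by (auto simp: represents_def)
  have sp: "space P = infinite_paths" using P(2) sets_eq_imp_space_eq space_path_space by metis
  have "\<P>(s in P. map s [0..<Suc (h + t)] = p \<bar> s (h + t) = (h, t)) =
      path_weight w1 w0 p / total_weight w1 w0 h t"
    if pos: "\<P>(s in P. s (h + t) = (h, t)) > 0" and p: "standard_path p" "last p = (h, t)" for h t p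
  proof -
    have "{s \<in> space P. map s [0..<Suc (h + t)] = p \<and> s (h + t) = (h, t)} = cylinder p"
      using cylinder_last[OF _ p(1)] length_standard_path[OF p(1)] p(2) unfolding sp
      by (auto simp: cylinder_def simp del: upt_Suc)
    then have "\<P>(s in P. map s [0..<Suc (h + t)] = p \<bar> s (h + t) = (h, t)) =
        measure P (cylinder p) / \<P>(s in P. s (h + t) = (h, t))"
      by (simp only: cond_prob_def)
    also have "\<dots> = path_weight w1 w0 p * f h t / (total_weight w1 w0 h t * f h t)"
      unfolding represents_coordinate[OF assms] cyl[OF p(1)] p(2) by simp
    \<comment> \<open>The vertex is reached with positive probability, so \<open>f h t\<close> is
      nonzero and cancels.\<close>
    also have "\<dots> = path_weight w1 w0 p / total_weight w1 w0 h t"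
      using pos unfolding represents_coordinate[OF assms] by auto
    finally show ?thesis .
  qed
  then show ?thesis using P unfolding path_laws_def by blast
qed

text \<open>By the conditioning property, path probability divided by path weight depends on the
  endpoint alone; \<open>f\<close> is the probability of the endpoint divided by its total
  weight.\<close>

lemma law_represented:
  assumes "P \<in> path_laws w1 w0"
  shows "\<exists>f. represents w1 w0 P f"
proof -
  have P: "prob_space P" "sets P = sets path_space"
    and cond: "\<And>h t p. \<P>(s in P. s (h + t) = (h, t)) > 0 \<Longrightarrow> standard_path p \<Longrightarrow> last p = (h, t) \<Longrightarrow>
      \<P>(s in P. map s [0..<Suc (h + t)] = p \<bar> s (h + t) = (h, t)) =
          path_weight w1 w0 p / total_weight w1 w0 h t"
    using assms unfolding path_laws_def by blast+
  interpret prob_space P by (rule P(1))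
  have sp: "space P = infinite_paths" using P(2) sets_eq_imp_space_eq space_path_space by metis
  define f where "f h t = \<P>(s in P. s (h + t) = (h, t)) / total_weight w1 w0 h t" for h t
  have "measure P (cylinder p) = path_weight w1 w0 p * f (fst (last p)) (snd (last p))"
    if p: "standard_path p" for p
  proof -
    obtain h t where ht: "last p = (h, t)" by fastforce
    have eq: "{s \<in> space P. map s [0..<Suc (h + t)] = p \<and> s (h + t) = (h, t)} = cylinder p"
      using cylinder_last[OF _ p] length_standard_path[OF p] ht unfolding sp
      by (auto simp: cylinder_def simp del: upt_Suc)
    show ?thesis
    proof (cases "\<P>(s in P. s (h + t) = (h, t)) > 0")
      case True
      then have "measure P (cylinder p) / \<P>(s in P. s (h + t) = (h, t)) =
          path_weight w1 w0 p / total_weight w1 w0 h t"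
        using cond[OF True p ht] unfolding cond_prob_def eq by simp
      then show ?thesis
        using True unfolding ht f_def by (simp add: nonzero_divide_eq_eq)
    next
      \<comment> \<open>At a vertex of probability 0 the function \<open>f\<close> is 0, and every
        cylinder ending there is null.\<close>
      case False
      then have 0: "\<P>(s in P. s (h + t) = (h, t)) = 0" by (simp add: zero_less_measure_iff)
      have "{s \<in> space P. s (h + t) = (h, t)} \<in> sets P"
        unfolding sp P(2) by (rule coordinate_sets)
      then have "measure P (cylinder p) \<le> \<P>(s in P. s (h + t) = (h, t))"
        unfolding eq[symmetric] by (intro finite_measure_mono) auto
      then show ?thesis
        using 0 measure_nonneg[of P "cylinder p"] unfolding ht f_def by simp
    qed
  qed
  then show ?thesis using P unfolding represents_def by blast
qed

text \<open>A cylinder is the disjoint union of its two one-step extensions. Dividing additivity by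
  the positive weight of the common path gives the equation for \<open>f\<close>.\<close>

lemma represents_harmonic:
  assumes "represents w1 w0 P f"
  shows "harmonic w1 w0 f" "f 0 0 = 1"
proof -
  have P: "prob_space P" "sets P = sets path_space"
    and cyl: "\<And>p. standard_path p \<Longrightarrow>
      measure P (cylinder p) = path_weight w1 w0 p * f (fst (last p)) (snd (last p))"
    using assms by (auto simp: represents_def)
  interpret prob_space P by (rule P(1))
  have sp: "space P = infinite_paths" using P(2) sets_eq_imp_space_eq space_path_space by metis
  show "f 0 0 = 1"
    using cyl[of "[(0, 0)]"] prob_space
    by (simp add: standard_path_singleton path_weight_singleton cylinder_singleton sp)
  show "harmonic w1 w0 f"
    unfolding harmonic_def
  proof (intro allI conjI)
    fix h t
    obtain p where p: "standard_path p" "last p = (h, t)" using exists_standard_path by blast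
    have ne: "p \<noteq> []" by (rule standard_path_nonempty[OF p(1)])
    let ?w = "path_weight w1 w0 p"
    have w: "0 < ?w" by (rule path_weight_pos)
    have "0 \<le> ?w * f h t" using cyl[OF p(1)] p(2) measure_nonneg[of P "cylinder p"] by simp
    then show "0 \<le> f h t" using w by (simp add: zero_le_mult_iff)
    let ?p = "p @ [(Suc h, t)]" and ?q = "p @ [(h, Suc t)]"
    have std: "standard_path ?p" "standard_path ?q"
      using p ne by (auto simp: standard_path_snoc lattice_edge_def)
    have "s (length p) = (Suc h, t) \<or> s (length p) = (h, Suc t)" if "s \<in> cylinder p" for s
    proof -
      have "lattice_edge (s (h + t)) (s (Suc (h + t)))"
        using that by (simp add: cylinder_def infinite_paths_def)
      then show ?thesis
        using cylinder_last[OF that p(1)] length_standard_path[OF p(1)] p(2)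
        by (auto simp: lattice_edge_def)
    qed
    then have "cylinder p = cylinder ?p \<union> cylinder ?q"
      by (intro set_eqI) (auto simp: cylinder_snoc)
    moreover have "measure P (cylinder ?p \<union> cylinder ?q) = measure P (cylinder ?p) + measure P (cylinder ?q)"
      using std cylinder_disjoint[of ?p ?q]
      by (intro finite_measure_Union) (auto simp: P(2) cylinder_sets)
    ultimately have "?w * f h t = ?w * w1 h t * f (Suc h) t + ?w * w0 h t * f h (Suc t)"
      using cyl[OF p(1)] cyl[OF std(1)] cyl[OF std(2)] p(2)
      by (simp add: path_weight_snoc[OF ne] edge_weight_def)
    then have "?w * f h t = ?w * (w1 h t * f (Suc h) t + w0 h t * f h (Suc t))"
      by (simp add: algebra_simps)
    then show "f h t = w1 h t * f (Suc h) t + w0 h t * f h (Suc t)"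
      using w by simp
  qed
qed

text \<open>Where \<open>f\<close> vanishes the division yields \<open>0\<close>, which is harmless: the chain never gets there.\<close>

definition right_prob :: "(nat \<Rightarrow> nat \<Rightarrow> real) \<Rightarrow> nat \<times> nat \<Rightarrow> real" where
  "right_prob f v = w1 (fst v) (snd v) * f (Suc (fst v)) (snd v) / f (fst v) (snd v)"

text \<open>This is the Doob transform by \<open>f\<close>. If \<open>f\<close> vanishes at
  \<open>v\<close>, positivity of the weights makes it vanish at both successors, so both sides are
  0 for any coin.\<close>

lemma harmonic_edge:
  assumes f: "harmonic w1 w0 f" and e: "lattice_edge v v'"
  shows "f (fst v) (snd v) * pmf (bernoulli_pmf (right_prob f v)) (fst v' \<noteq> fst v) =
    edge_weight w1 w0 v v' * f (fst v') (snd v')"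
proof -
  obtain h t where v: "v = (h, t)" by fastforce
  have s: "f h t = w1 h t * f (Suc h) t + w0 h t * f h (Suc t)" by (rule harmonic_step[OF f])
  have n: "0 \<le> w1 h t * f (Suc h) t" "0 \<le> w0 h t * f h (Suc t)"
    using harmonic_nonneg[OF f] w1_pos w0_pos by (simp_all add: less_imp_le)
  show ?thesis
  proof (cases "f h t = 0")
    case True
    then have "w1 h t * f (Suc h) t = 0" "w0 h t * f h (Suc t) = 0" using s n by linarith+
    then show ?thesis using e True by (auto simp: v lattice_edge_def edge_weight_def)
  next
    case False
    then have pos: "0 < f h t" using harmonic_nonneg[OF f, of h t] by simp
    let ?q = "w1 h t * f (Suc h) t / f h t"
    have q: "0 \<le> ?q" "?q \<le> 1" using n s pos by (auto simp: divide_le_eq)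
    have "f h t * (1 - ?q) = w0 h t * f h (Suc t)" using s False by (simp add: right_diff_distrib)
    moreover have "f h t * ?q = w1 h t * f (Suc h) t" using False by simp
    ultimately show ?thesis using e q
      by (auto simp: v lattice_edge_def edge_weight_def right_prob_def pmf_bernoulli_True pmf_bernoulli_False)
  qed
qed

text \<open>Multiplying \<open>harmonic_edge\<close> along the path telescopes the values of
  \<open>f\<close>; only the one at the endpoint survives, as \<open>f 0 0 = 1\<close>.\<close>

lemma path_weight_harmonic:
  assumes f: "harmonic w1 w0 f" "f 0 0 = 1" and p: "standard_path p"
  shows "path_weight w1 w0 p * f (fst (last p)) (snd (last p)) =
    (\<Prod>i<length p - 1. pmf (bernoulli_pmf (right_prob f (p ! i))) (turns_right p i))"
  using p
proof (induction p rule: standard_path_induct)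
  case singleton
  then show ?case using f(2) by (simp add: path_weight_singleton)
next
  case (snoc p v)
  have ne: "p \<noteq> []" by (rule standard_path_nonempty[OF snoc.hyps(1)])
  then obtain n where n: "length p = Suc n" by (cases p) auto
  have last: "last p = p ! n" using n ne by (simp add: last_conv_nth)
  have tr: "turns_right (p @ [v]) n \<longleftrightarrow> fst v \<noteq> fst (last p)"
    using n last by (simp add: turns_right_def nth_append)
  have "path_weight w1 w0 (p @ [v]) * f (fst (last (p @ [v]))) (snd (last (p @ [v]))) =
      path_weight w1 w0 p * (f (fst (last p)) (snd (last p)) *
        pmf (bernoulli_pmf (right_prob f (last p))) (turns_right (p @ [v]) n))"
    unfolding tr harmonic_edge[OF f(1) snoc.hyps(2)] by (simp add: path_weight_snoc[OF ne])
  also have "\<dots> = (\<Prod>i<n. pmf (bernoulli_pmf (right_prob f (p ! i))) (turns_right p i)) *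
      pmf (bernoulli_pmf (right_prob f (last p))) (turns_right (p @ [v]) n)"
    using snoc.IH n by simp
  also have "(\<Prod>i<n. pmf (bernoulli_pmf (right_prob f (p ! i))) (turns_right p i)) =
      (\<Prod>i<n. pmf (bernoulli_pmf (right_prob f ((p @ [v]) ! i))) (turns_right (p @ [v]) i))"
    using n by (intro prod.cong) (auto simp: nth_append turns_right_append)
  finally show ?case using n last by (simp add: nth_append)
qed

lemma harmonic_represents:
  assumes f: "harmonic w1 w0 f" "f 0 0 = 1"
  shows "\<exists>P. represents w1 w0 P f"
proof -
  define B where "B v = bernoulli_pmf (right_prob f v)" for v
  let ?M = "\<Pi>\<^sub>M v\<in>UNIV. measure_pmf (B v)"
  have m: "coin_path \<in> measurable ?M path_space"
  proof -
    have c: "(\<lambda>\<omega>. \<omega> v) \<in> measurable ?M (count_space UNIV)" for v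
      using measurable_component_singleton[of v UNIV "\<lambda>v. measure_pmf (B v)"] by simp
    have "(\<lambda>\<omega>. coin_path \<omega> n) \<in> measurable ?M (count_space UNIV)" for n
    proof (induction n)
      case (Suc n)
      have "(\<lambda>\<omega>. (\<lambda>v \<omega>. v + step (\<omega> v)) (coin_path \<omega> n) \<omega>) \<in> measurable ?M (count_space UNIV)"
        by (rule measurable_compose_countable[OF _ Suc], rule measurable_compose[OF c]) simp
      then show ?case by simp
    qed simp
    then have "coin_path \<in> measurable ?M (\<Pi>\<^sub>M n\<in>UNIV. count_space UNIV)"
      by (intro measurable_PiM_single') auto
    then show ?thesis
      unfolding path_space_def by (intro measurable_restrict_space2) (auto simp: coin_path_infinite)
  qed
  define P where "P = distr ?M path_space coin_path"
  have "measure P (cylinder p) = path_weight w1 w0 p * f (fst (last p)) (snd (last p))"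
    if p: "standard_path p" for p
  proof -
    \<comment> \<open>Different positions of a path lie on different levels, so the inspected coins
      are distinct and the product over vertices is a product over positions.\<close>
    have inj: "inj_on ((!) p) {..<length p - 1}"
    proof (rule inj_onI)
      fix i j assume ij: "i \<in> {..<length p - 1}" "j \<in> {..<length p - 1}" "p ! i = p ! j"
      have "fst (p ! j) + snd (p ! j) = i"
        unfolding ij(3)[symmetric] using ij(1) by (intro standard_path_nth_sum[OF p]) simp
      moreover have "fst (p ! j) + snd (p ! j) = j"
        using ij(2) by (intro standard_path_nth_sum[OF p]) simp
      ultimately show "i = j" by (rule trans[OF sym])
    qed
    define d where "d v = turns_right p (fst v + snd v)" for v
    have d: "d (p ! i) = turns_right p i" if "i < length p - 1" for i
    proof -
      have "fst (p ! i) + snd (p ! i) = i" using that by (intro standard_path_nth_sum[OF p]) simp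
      then show ?thesis by (simp only: d_def)
    qed
    have "measure P (cylinder p) = measure ?M (coin_path -` cylinder p \<inter> space ?M)"
      unfolding P_def using p by (intro measure_distr m cylinder_sets)
    also have "coin_path -` cylinder p \<inter> space ?M = {\<omega>. \<forall>v\<in>(!) p ` {..<length p - 1}. \<omega> v = d v}"
      using coin_path_cylinder[OF p] d by (auto simp: space_PiM)
    also have "measure ?M \<dots> = (\<Prod>v\<in>(!) p ` {..<length p - 1}. pmf (B v) (d v))"
      by (rule measure_PiM_pmf) simp
    also have "\<dots> = (\<Prod>i<length p - 1. pmf (B (p ! i)) (turns_right p i))"
      unfolding prod.reindex[OF inj] by (intro prod.cong) (auto simp: d)
    finally show ?thesis unfolding B_def path_weight_harmonic[OF f p] .
  qed
  moreover have "prob_space P"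
    unfolding P_def by (intro prob_space.prob_space_distr prob_space_PiM prob_space_measure_pmf m)
  ultimately show ?thesis unfolding represents_def by (intro exI[of _ P]) (simp add: P_def)
qed

text \<open>Cylinder probabilities are values of the functions times a common positive weight, and
  every vertex ends some path; so affine relations pass in both directions.\<close>

lemma represents_combination:
  assumes P: "represents w1 w0 P f" and Q: "represents w1 w0 Q g" and R: "represents w1 w0 R k"
  shows "(\<forall>A\<in>sets P. measure P A = (1 - u) * measure Q A + u * measure R A) \<longleftrightarrow>
    (\<forall>h t. f h t = (1 - u) * g h t + u * k h t)" (is "?l \<longleftrightarrow> ?r")
proof
  assume l: ?l
  show ?r
  proof (intro allI)
    fix h t
    obtain p where p: "standard_path p" "last p = (h, t)" using exists_standard_path by blast
    have "cylinder p \<in> sets P" using P p(1) by (simp add: represents_def cylinder_sets)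
    note * = l[rule_format, OF this]
    have "measure P (cylinder p) = path_weight w1 w0 p * f h t"
      "measure Q (cylinder p) = path_weight w1 w0 p * g h t"
      "measure R (cylinder p) = path_weight w1 w0 p * k h t"
      using P Q R p unfolding represents_def by (metis fst_conv snd_conv)+
    then have "path_weight w1 w0 p * f h t =
        (1 - u) * (path_weight w1 w0 p * g h t) + u * (path_weight w1 w0 p * k h t)"
      using * by simp
    then have "path_weight w1 w0 p * f h t = path_weight w1 w0 p * ((1 - u) * g h t + u * k h t)"
      by (simp add: algebra_simps)
    then show "f h t = (1 - u) * g h t + u * k h t" using path_weight_pos[of p] by simp
  qed
next
  assume r: ?r
  have "measure P (cylinder p) = (1 - u) * measure Q (cylinder p) + u * measure R (cylinder p)"
    if "standard_path p" for p
    using P Q R that r by (simp add: represents_def algebra_simps)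
  moreover have "prob_space P" "sets P = sets path_space" "prob_space Q" "sets Q = sets path_space"
    "prob_space R" "sets R = sets path_space"
    using P Q R by (simp_all add: represents_def)
  ultimately show ?l using law_combination[of P Q R u] by blast
qed

text \<open>Laws and normalised harmonic functions correspond bijectively and affinely, which
  preserves extremality.\<close>

lemma extreme_law_iff:
  assumes P: "represents w1 w0 P f"
  shows "P \<in> extreme_laws (path_laws w1 w0) \<longleftrightarrow>
    extreme_harmonic w1 w0 f" (is "?l \<longleftrightarrow> ?r")
proof
  assume l: ?l
  show ?r unfolding extreme_harmonic_def
  proof (intro allI impI, elim conjE)
    fix g k and u :: real
    assume g: "harmonic w1 w0 g" "g 0 0 = 1" and k: "harmonic w1 w0 k" "k 0 0 = 1"
      and u: "0 < u" "u < 1" and eq: "\<forall>h t. f h t = (1 - u) * g h t + u * k h t"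
    obtain Q R where Q: "represents w1 w0 Q g" and R: "represents w1 w0 R k"
      using harmonic_represents g k by blast
    have "Q = R"
    proof (rule ccontr)
      assume "Q \<noteq> R"
      moreover have "\<forall>A\<in>sets P. measure P A = (1 - u) * measure Q A + u * measure R A"
        using represents_combination[OF P Q R] eq by blast
      ultimately show False
        using l u represents_imp_law[OF Q] represents_imp_law[OF R]
        unfolding extreme_laws_def by blast
    qed
    have "g h t = k h t" for h t
    proof -
      obtain p where p: "standard_path p" "last p = (h, t)" using exists_standard_path by blast
      then have "path_weight w1 w0 p * g h t = path_weight w1 w0 p * k h t"
        using Q R \<open>Q = R\<close> unfolding represents_def by (metis fst_conv snd_conv)
      then show ?thesis using path_weight_pos[of p] by simp
    qed
    then show "g = k" by blast
  qed
next
  assume r: ?r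
  have "Q = R" if Q: "Q \<in> path_laws w1 w0" and R: "R \<in> path_laws w1 w0" and u: "0 < u" "u < 1"
    and eq: "\<forall>A\<in>sets P. measure P A = (1 - u) * measure Q A + u * measure R A" for Q R and u :: real
  proof -
    obtain g k where g: "represents w1 w0 Q g" and k: "represents w1 w0 R k"
      using law_represented Q R by blast
    then have "g = k"
      using r[unfolded extreme_harmonic_def] represents_combination[OF P g k] represents_harmonic[OF g] represents_harmonic[OF k] u eq
      by blast
    then show ?thesis using represents_unique g k by blast
  qed
  then show ?l unfolding extreme_laws_def using represents_imp_law[OF P] by blast
qed

lemma represents_first_step:
  assumes "represents w1 w0 P f"
  shows "first_step_prob P = w1 0 0 * f 1 0"
proof -
  have P: "sets P = sets path_space" using assms by (simp add: represents_def)
  have sp: "space P = infinite_paths" using P sets_eq_imp_space_eq space_path_space by metis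
  let ?p = "[(0, 0)] @ [(1, 0)] :: (nat \<times> nat) list"
  have "{s \<in> space P. fst (s 1) = 1} = cylinder ?p"
  proof (intro set_eqI)
    fix s
    have "fst (s 1) = 1 \<longleftrightarrow> s 1 = (1, 0)" if "s \<in> infinite_paths"
      using infinite_path_level[OF that, of 1] by (auto simp: prod_eq_iff)
    then show "s \<in> {s \<in> space P. fst (s 1) = 1} \<longleftrightarrow> s \<in> cylinder ?p"
      unfolding cylinder_snoc cylinder_singleton sp by auto
  qed
  moreover have "standard_path ?p"
    by (subst standard_path_snoc) (auto simp: standard_path_singleton lattice_edge_def)
  then have "measure P (cylinder ?p) = path_weight w1 w0 ?p * f 1 0"
    using assms unfolding represents_def by (metis fst_conv last_snoc snd_conv)
  moreover have "path_weight w1 w0 ?p = w1 0 0"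
    by (subst path_weight_snoc) (auto simp: path_weight_singleton edge_weight_def)
  ultimately show ?thesis by (simp add: first_step_prob_def)
qed

text \<open>Of the two successors of a vertex at most one lies on \<open>x\<close>, and
  \<open>f\<close> vanishes at the other. Harmonicity thus hands the whole value
  \<open>f h t\<close> to the successor on \<open>x\<close>.\<close>

lemma represents_return:
  assumes x: "x \<in> infinite_paths" and f: "harmonic w1 w0 f" "f 0 0 = 1"
    and zero: "\<And>v. v \<noteq> x (fst v + snd v) \<Longrightarrow> f (fst v) (snd v) = 0"
  shows "represents w1 w0 (return path_space x) f"
proof -
  have "indicator (cylinder p) x = path_weight w1 w0 p * f (fst (last p)) (snd (last p))"
    if "standard_path p" for p
    using that
  proof (induction p rule: standard_path_induct)
    case singleton
    then show ?case using x f by (simp add: cylinder_singleton path_weight_singleton)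
  next
    case (snoc p v)
    have ne: "p \<noteq> []" by (rule standard_path_nonempty[OF snoc.hyps(1)])
    obtain n where n: "length p = Suc n" using ne by (cases p) auto
    obtain h t where ht: "last p = (h, t)" by fastforce
    have lp: "h + t = n" using length_standard_path[OF snoc.hyps(1)] n ht by simp
    have e: "v = (Suc h, t) \<or> v = (h, Suc t)" using snoc.hyps(2) ht by (auto simp: lattice_edge_def)
    have hs: "f h t = w1 h t * f (Suc h) t + w0 h t * f h (Suc t)" by (rule harmonic_step[OF f(1)])
    have key: "edge_weight w1 w0 (last p) v * f (fst v) (snd v) =
        (if v = x (Suc n) then f h t else 0)"
    proof (cases "v = x (Suc n)")
      case True
      then show ?thesis
        using e hs zero[of "(Suc h, t)"] zero[of "(h, Suc t)"] lp
        by (auto simp: edge_weight_def ht)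
    next
      case False
      then show ?thesis using zero[of v] e lp by auto
    qed
    have "x \<in> cylinder (p @ [v]) \<longleftrightarrow> x \<in> cylinder p \<and> v = x (Suc n)"
      using n by (auto simp: cylinder_snoc)
    then have "indicator (cylinder (p @ [v])) x =
        (indicator (cylinder p) x * (if v = x (Suc n) then 1 else 0) :: real)"
      by (simp add: indicator_def)
    also have "\<dots> = path_weight w1 w0 p * (if v = x (Suc n) then f h t else 0)"
      using snoc.IH ht by simp
    also have "\<dots> = path_weight w1 w0 (p @ [v]) * f (fst v) (snd v)"
      unfolding key[symmetric] by (simp add: path_weight_snoc[OF ne])
    finally show ?case by simp
  qed
  then show ?thesis
    unfolding represents_def
    by (auto simp: measure_return cylinder_sets prob_space_return space_path_space x)
qed

end

section \<open>Exchanging a step with a random step of a block\<close>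

lemma divide_le_one_nonneg: "0 \<le> y \<Longrightarrow> x \<le> y \<Longrightarrow> x / y \<le> 1" for x y :: real
  by (cases "y = 0") simp_all

locale positive_sequence =
  fixes a :: "nat \<Rightarrow> real"
  assumes a_pos: "0 < a n"

sublocale positive_sequence \<subseteq> positive_weights "\<lambda>h t. 1" "\<lambda>h t. a (h + t)"
  by unfold_locales (simp_all add: a_pos)

context positive_sequence
begin

section \<open>Sums over path segments, and the masses of a block of times\<close>

definition block_sum ::
  "nat set \<Rightarrow> (nat set \<Rightarrow> real) \<Rightarrow> (nat \<Rightarrow> real) \<Rightarrow> nat \<Rightarrow> real" where
  "block_sum S Y g h = (\<Sum>A\<in>Pow S. (\<Prod>i\<in>S - A. a i) * Y A * g (h + card A))"

text \<open>In \<open>block_sum\<close> and below, \<open>A\<close> encodes a path segment by the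
  times of its horizontal steps. A vertical step at time \<open>i\<close> contributes the weight
  \<open>a i\<close>, and the segment ends at first coordinate \<open>h + card A\<close>.\<close>

definition head_mass :: "nat set \<Rightarrow> nat set \<Rightarrow> real" where
  "head_mass J A = (\<Sum>j\<in>J \<inter> A. a j / (1 + a j))"

definition tail_mass :: "nat set \<Rightarrow> nat set \<Rightarrow> real" where
  "tail_mass J A = (\<Sum>j\<in>J - A. 1 / (1 + a j))"

definition head_frac :: "nat set \<Rightarrow> nat set \<Rightarrow> real" where
  "head_frac J A = head_mass J A / (head_mass J A + tail_mass J A)"

text \<open>Each summand is the variance of the indicator of a horizontal step under independent
  increments with \<open>\<theta> = 1\<close>.\<close>

definition var_mass :: "nat set \<Rightarrow> real" where
  "var_mass J = (\<Sum>j\<in>J. a j / (1 + a j)\<^sup>2)"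

text \<open>Splits by the step at time \<open>n\<close>: a horizontal one raises \<open>h\<close>, a
  vertical one contributes \<open>a n\<close>. The statistic does not see the difference.\<close>

lemma block_sum_insert:
  assumes "finite S" "n \<notin> S" "\<And>A. A \<subseteq> S \<Longrightarrow> Y (insert n A) = Y A"
  shows "block_sum (insert n S) Y g h = block_sum S Y g (Suc h) + a n * block_sum S Y g h"
proof -
  let ?s = "\<lambda>A. (\<Prod>i\<in>insert n S - A. a i) * Y A * g (h + card A)"
  have "block_sum (insert n S) Y g h = sum ?s (Pow S) + sum ?s (insert n ` Pow S)"
    unfolding block_sum_def Pow_insert using assms(1,2) by (intro sum.union_disjoint) auto
  also have "sum ?s (Pow S) = a n * block_sum S Y g h"
    unfolding block_sum_def sum_distrib_left
  proof (intro sum.cong refl)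
    fix A assume "A \<in> Pow S"
    then have "insert n S - A = insert n (S - A)" using assms(2) by auto
    then show "?s A = a n * ((\<Prod>i\<in>S - A. a i) * Y A * g (h + card A))"
      using assms(1,2) by simp
  qed
  also have "sum ?s (insert n ` Pow S) = sum (\<lambda>A. ?s (insert n A)) (Pow S)"
    using assms(2) by (subst sum.reindex) (auto simp: inj_on_def)
  also have "\<dots> = block_sum S Y g (Suc h)"
    unfolding block_sum_def
  proof (intro sum.cong refl)
    fix A assume A: "A \<in> Pow S"
    then have "insert n S - insert n A = S - A" "n \<notin> A" "finite A"
      using assms(1,2) by (auto intro: finite_subset)
    then show "?s (insert n A) = (\<Prod>i\<in>S - A. a i) * Y A * g (Suc h + card A)"
      using A assms(3) by simp
  qed
  finally show ?thesis by simp
qed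

lemma block_sum_mono:
  assumes "\<And>A. A \<subseteq> S \<Longrightarrow> Y A * g (h + card A) \<le> Y' A * g' (h' + card A)"
  shows "block_sum S Y g h \<le> block_sum S Y' g' h'"
  unfolding block_sum_def mult.assoc
  using assms a_pos by (intro sum_mono mult_left_mono prod_nonneg) (auto intro: less_imp_le)

lemma block_sum_cmult: "block_sum S (\<lambda>A. c * Y A) g h = c * block_sum S Y g h"
  by (simp add: block_sum_def sum_distrib_left algebra_simps)

lemma block_sum_add:
  "block_sum S (\<lambda>A. Y A + Y' A) g h = block_sum S Y g h + block_sum S Y' g h"
  by (simp add: block_sum_def sum.distrib algebra_simps)

lemma block_sum_diff:
  "block_sum S (\<lambda>A. Y A - Y' A) g h = block_sum S Y g h - block_sum S Y' g h"
  by (simp add: block_sum_def sum_subtractf algebra_simps)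

section \<open>The exchange estimate\<close>

lemma block_sum_tail_mass:
  assumes "finite S" "J \<subseteq> S"
  shows "block_sum S (\<lambda>A. tail_mass J A * \<phi> A) g (Suc h) =
    (\<Sum>j\<in>J. \<Sum>A\<in>Pow (S - {j}). (\<Prod>i\<in>S - A. a i) * \<phi> A * g (Suc (h + card A)) / (1 + a j))"
proof -
  have fJ: "finite J" using assms finite_subset by blast
  let ?s = "\<lambda>j A. (\<Prod>i\<in>S - A. a i) * \<phi> A * g (Suc (h + card A)) / (1 + a j)"
  have "block_sum S (\<lambda>A. tail_mass J A * \<phi> A) g (Suc h) =
      (\<Sum>A\<in>Pow S. \<Sum>j | j \<in> J \<and> j \<notin> A. ?s j A)"
    unfolding block_sum_def tail_mass_def set_diff_eq
    by (intro sum.cong refl) (simp only: sum_distrib_left sum_distrib_right, simp)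
  also have "\<dots> = (\<Sum>j\<in>J. \<Sum>A | A \<in> Pow S \<and> j \<notin> A. ?s j A)"
    using assms(1) fJ by (intro sum.swap_restrict) auto
  also have "\<dots> = (\<Sum>j\<in>J. \<Sum>A\<in>Pow (S - {j}). ?s j A)"
    by (intro sum.cong) auto
  finally show ?thesis .
qed

text \<open>Each set containing \<open>j\<close> is written as \<open>insert j A\<close>. The factor
  \<open>a j\<close> of the head mass completes the product over \<open>S - insert j A\<close> to
  the product over \<open>S - A\<close>, so the summands are those of
  \<open>block_sum_tail_mass\<close>, except that \<open>\<phi>\<close> is taken at
  \<open>insert j A\<close>.\<close>

lemma block_sum_head_mass:
  assumes "finite S" "J \<subseteq> S"
  shows "block_sum S (\<lambda>A. head_mass J A * \<phi> A) g h =
    (\<Sum>j\<in>J. \<Sum>A\<in>Pow (S - {j}).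
      (\<Prod>i\<in>S - A. a i) * \<phi> (insert j A) * g (Suc (h + card A)) / (1 + a j))"
proof -
  have fJ: "finite J" using assms finite_subset by blast
  let ?s = "\<lambda>j A. (\<Prod>i\<in>S - A. a i) * (a j * \<phi> A) * g (h + card A) / (1 + a j)"
  have "block_sum S (\<lambda>A. head_mass J A * \<phi> A) g h =
      (\<Sum>A\<in>Pow S. \<Sum>j | j \<in> J \<and> j \<in> A. ?s j A)"
    unfolding block_sum_def head_mass_def Int_def
    by (intro sum.cong refl) (simp only: sum_distrib_left sum_distrib_right, simp)
  also have "\<dots> = (\<Sum>j\<in>J. \<Sum>A | A \<in> Pow S \<and> j \<in> A. ?s j A)"
    using assms(1) fJ by (intro sum.swap_restrict) auto
  also have "\<dots> = (\<Sum>j\<in>J. \<Sum>A\<in>Pow (S - {j}).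
      (\<Prod>i\<in>S - A. a i) * \<phi> (insert j A) * g (Suc (h + card A)) / (1 + a j))"
  proof (rule sum.cong[OF refl])
    fix j assume j: "j \<in> J"
    have eq: "{A \<in> Pow S. j \<in> A} = insert j ` Pow (S - {j})"
    proof (intro set_eqI iffI)
      fix A assume "A \<in> {A \<in> Pow S. j \<in> A}"
      then have "A = insert j (A - {j})" "A - {j} \<in> Pow (S - {j})" by auto
      then show "A \<in> insert j ` Pow (S - {j})" by blast
    qed (use j assms(2) in auto)
    have "(\<Sum>A | A \<in> Pow S \<and> j \<in> A. ?s j A) = (\<Sum>A\<in>Pow (S - {j}). ?s j (insert j A))"
      unfolding eq by (subst sum.reindex) (auto intro!: inj_onI dest: insert_ident[THEN iffD1, rotated 2])
    also have "\<dots> = (\<Sum>A\<in>Pow (S - {j}).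
      (\<Prod>i\<in>S - A. a i) * \<phi> (insert j A) * g (Suc (h + card A)) / (1 + a j))"
    proof (intro sum.cong refl)
      fix A assume A: "A \<in> Pow (S - {j})"
      then have eq: "S - insert j A = (S - A) - {j}" and "j \<in> S - A" "finite A"
        using j assms by (auto intro: finite_subset)
      then have "(\<Prod>i\<in>S - insert j A. a i) * a j = (\<Prod>i\<in>S - A. a i)"
        unfolding eq using assms(1) by (subst (2) prod.remove[of _ j]) (auto simp: mult.commute)
      then show "?s j (insert j A) =
          (\<Prod>i\<in>S - A. a i) * \<phi> (insert j A) * g (Suc (h + card A)) / (1 + a j)"
        using \<open>finite A\<close> \<open>j \<in> S - A\<close> by (simp add: mult.assoc[symmetric])
    qed
    finally show "(\<Sum>A | A \<in> Pow S \<and> j \<in> A. ?s j A) = (\<Sum>A\<in>Pow (S - {j}).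
      (\<Prod>i\<in>S - A. a i) * \<phi> (insert j A) * g (Suc (h + card A)) / (1 + a j))" .
  qed
  finally show ?thesis .
qed

lemma head_mass_nonneg: "0 \<le> head_mass J A"
  unfolding head_mass_def by (intro sum_nonneg) (simp add: a_pos less_imp_le add_pos_pos)

lemma tail_mass_nonneg: "0 \<le> tail_mass J A"
  unfolding tail_mass_def by (intro sum_nonneg) (simp add: a_pos less_imp_le add_pos_pos)

text \<open>Each time of the block contributes \<open>a j / (1 + a j)\<close> or
  \<open>1 / (1 + a j)\<close>. Both are at most 1, so their product is below either of
  them.\<close>

lemma var_mass_le:
  assumes "finite J"
  shows "var_mass J \<le> head_mass J A + tail_mass J A"
proof -
  have "var_mass J = (\<Sum>j\<in>J \<inter> A. a j / (1 + a j)\<^sup>2) + (\<Sum>j\<in>J - A. a j / (1 + a j)\<^sup>2)"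
    unfolding var_mass_def using assms by (rule sum.Int_Diff)
  also have "\<dots> \<le> head_mass J A + tail_mass J A"
    unfolding head_mass_def tail_mass_def
  proof (intro add_mono sum_mono)
    fix j
    have "a j / (1 + a j) \<le> 1" using a_pos[of j] by simp
    then have "a j / (1 + a j) * (1 / (1 + a j)) \<le> 1 * (1 / (1 + a j))"
      using a_pos[of j] by (intro mult_right_mono) auto
    moreover have "a j / (1 + a j) * (1 / (1 + a j)) \<le> a j / (1 + a j) * 1"
      using a_pos[of j] by (intro mult_left_mono) auto
    ultimately show "a j / (1 + a j)\<^sup>2 \<le> a j / (1 + a j)" "a j / (1 + a j)\<^sup>2 \<le> 1 / (1 + a j)"
      by (simp_all add: power2_eq_square)
  qed
  finally show ?thesis .
qed

lemma var_mass_unbounded: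
  assumes "(\<Sum>n. ennreal (a n / (1 + a n)\<^sup>2)) = \<infinity>"
  shows "\<exists>n. c \<le> var_mass {k..<n}"
proof (rule ccontr)
  assume "\<nexists>n. c \<le> var_mass {k..<n}"
  then have less: "var_mass {k..<n} < c" for n by (meson not_le)
  have pos: "0 \<le> a n / (1 + a n)\<^sup>2" for n using a_pos[of n] by simp
  have "(\<Sum>i<n. a i / (1 + a i)\<^sup>2) \<le> var_mass {..<k} + c" for n
  proof -
    have "(\<Sum>i<n. a i / (1 + a i)\<^sup>2) \<le> var_mass ({..<k} \<union> {k..<n})"
      unfolding var_mass_def using pos by (intro sum_mono2) auto
    also have "\<dots> = var_mass {..<k} + var_mass {k..<n}"
      unfolding var_mass_def by (intro sum.union_disjoint) auto
    finally show ?thesis using less[of n] by simp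
  qed
  then have "summable (\<lambda>n. a n / (1 + a n)\<^sup>2)"
    using pos by (intro summableI_nonneg_bounded)
  then show False using suminf_ennreal2[OF pos] assms by simp
qed

lemma head_frac_bounds:
  shows "0 \<le> head_frac J A" "head_frac J A \<le> 1"
  using head_mass_nonneg[of J A] tail_mass_nonneg[of J A]
  unfolding head_frac_def by (auto intro: divide_le_one_nonneg)

lemma mass_insert:
  assumes "finite J" "j \<in> J" "j \<notin> A"
  shows "head_mass J (insert j A) = head_mass J A + a j / (1 + a j)"
    and "tail_mass J (insert j A) = tail_mass J A - 1 / (1 + a j)"
proof -
  have eq: "J \<inter> insert j A = insert j (J \<inter> A)" "J - insert j A = (J - A) - {j}"
    using assms by auto
  have "finite (J \<inter> A)" "j \<notin> J \<inter> A" using assms by auto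
  then show "head_mass J (insert j A) = head_mass J A + a j / (1 + a j)"
    unfolding head_mass_def eq by (subst sum.insert) auto
  have "finite (J - A)" "j \<in> J - A" using assms by auto
  then show "tail_mass J (insert j A) = tail_mass J A - 1 / (1 + a j)"
    unfolding tail_mass_def eq by (subst sum_diff1) auto
qed

text \<open>Moving \<open>j\<close> to the heads changes the head mass by at most 1 and the total
  \<open>Z\<close> by \<open>(a j - 1) / (1 + a j)\<close>, also at most 1 in absolute value, and
  \<open>Z\<close> never falls below \<open>var_mass J\<close>. The constant 3 is 2 for the change
  of \<open>head_frac\<close> plus 1 for that of the reciprocal. The factor \<open>1 / Z A\<close>
  is retained because the exchange adds up over all \<open>j\<close>.\<close>

lemma inverse_mass_insert:
  assumes J: "finite J" "j \<in> J" "j \<notin> A" and V: "0 < var_mass J"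
  defines "Z \<equiv> \<lambda>A. head_mass J A + tail_mass J A"
  shows "\<bar>1 / Z A - 1 / Z (insert j A)\<bar> \<le> 1 / var_mass J / Z A"
    and "\<bar>head_frac J A / Z A - head_frac J (insert j A) / Z (insert j A)\<bar>
      \<le> 3 / var_mass J / Z A"
proof -
  let ?V = "var_mass J" and ?A = "insert j A"
  have Z: "?V \<le> Z A" "?V \<le> Z ?A" "0 < Z A" "0 < Z ?A"
    using var_mass_le[OF J(1)] V unfolding Z_def by (auto intro: less_le_trans)
  have d: "Z ?A - Z A = (a j - 1) / (1 + a j)"
    using mass_insert[OF J] by (simp add: Z_def diff_divide_distrib)
  have d1: "\<bar>Z ?A - Z A\<bar> \<le> 1"
    unfolding d using a_pos[of j] by (auto simp: abs_le_iff field_simps)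
  have "1 / Z A - 1 / Z ?A = (Z ?A - Z A) / Z A / Z ?A"
    using Z by (simp add: diff_divide_distrib)
  then have "\<bar>1 / Z A - 1 / Z ?A\<bar> = \<bar>Z ?A - Z A\<bar> / Z A / Z ?A"
    using Z by (simp add: abs_mult)
  also have "\<dots> \<le> 1 / Z A / ?V"
    using Z V d1 by (intro frac_le divide_right_mono divide_nonneg_pos) auto
  finally show *: "\<bar>1 / Z A - 1 / Z ?A\<bar> \<le> 1 / ?V / Z A" by (simp add: mult.commute)
  have hd: "head_mass J ?A - head_mass J A = a j / (1 + a j)"
    using mass_insert(1)[OF J] by simp
  have hd1: "\<bar>head_mass J ?A - head_mass J A\<bar> \<le> 1"
    unfolding hd using a_pos[of j] by (simp add: field_simps)
  have fr: "head_frac J B = head_mass J B / Z B" for B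
    by (simp add: head_frac_def Z_def)
  have fd: "head_frac J A - head_frac J ?A =
      (head_frac J A * (Z ?A - Z A) - (head_mass J ?A - head_mass J A)) / Z ?A"
    unfolding fr using Z by (simp add: divide_simps) (simp add: algebra_simps)
  have "\<bar>head_frac J A * (Z ?A - Z A)\<bar> \<le> 1 * 1"
    unfolding abs_mult using head_frac_bounds[of J A] d1 by (intro mult_mono) auto
  then have "\<bar>head_frac J A - head_frac J ?A\<bar> \<le> 2 / ?V"
    unfolding fd abs_divide using hd1 Z V by (intro frac_le) auto
  then have "\<bar>(head_frac J A - head_frac J ?A) / Z A\<bar> \<le> 2 / ?V / Z A"
    unfolding abs_divide abs_of_pos[OF Z(3)] using Z by (intro divide_right_mono) auto
  moreover have "\<bar>head_frac J ?A * (1 / Z A - 1 / Z ?A)\<bar> \<le> 1 * (1 / ?V / Z A)"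
    unfolding abs_mult using head_frac_bounds[of J ?A] * by (intro mult_mono) auto
  moreover have "head_frac J A / Z A - head_frac J ?A / Z ?A =
      (head_frac J A - head_frac J ?A) / Z A + head_frac J ?A * (1 / Z A - 1 / Z ?A)"
    by (simp add: right_diff_distrib diff_divide_distrib)
  moreover have "2 / ?V / Z A + 1 * (1 / ?V / Z A) = 3 / ?V / Z A"
    by (simp add: add_divide_distrib[symmetric])
  ultimately show "\<bar>head_frac J A / Z A - head_frac J ?A / Z ?A\<bar> \<le> 3 / ?V / Z A"
    by linarith
qed

text \<open>After matching summands only the differences
  \<open>\<phi> A - \<phi> (insert j A)\<close> remain. Their bounds, weighted by
  \<open>1 / (1 + a j)\<close> and summed over \<open>j\<close>, give \<open>e\<close> times
  \<open>tail_mass\<close> over the total mass, hence at most \<open>e\<close>: the number of swaps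
  does not enter.\<close>

lemma block_sum_exchange:
  assumes g: "\<And>c. 0 \<le> g c" and S: "finite S" "J \<subseteq> S"
    and e: "0 \<le> e"
    and lip: "\<And>A j. A \<subseteq> S \<Longrightarrow> j \<in> J - A \<Longrightarrow>
      \<bar>\<phi> A - \<phi> (insert j A)\<bar> \<le> e / (head_mass J A + tail_mass J A)"
  shows "\<bar>block_sum S (\<lambda>A. tail_mass J A * \<phi> A) g (Suc h) -
      block_sum S (\<lambda>A. head_mass J A * \<phi> A) g h\<bar> \<le> e * block_sum S (\<lambda>_. 1) g (Suc h)"
proof -
  let ?Z = "\<lambda>A. head_mass J A + tail_mass J A"
  let ?c = "\<lambda>j A. (\<Prod>i\<in>S - A. a i) * g (Suc (h + card A)) / (1 + a j)"
  have c: "0 \<le> ?c j A" for j A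
    using a_pos g by (intro divide_nonneg_pos mult_nonneg_nonneg prod_nonneg)
      (auto intro: less_imp_le add_pos_pos)
  have "\<bar>block_sum S (\<lambda>A. tail_mass J A * \<phi> A) g (Suc h) -
      block_sum S (\<lambda>A. head_mass J A * \<phi> A) g h\<bar> =
      \<bar>\<Sum>j\<in>J. \<Sum>A\<in>Pow (S - {j}). ?c j A * (\<phi> A - \<phi> (insert j A))\<bar>"
    unfolding block_sum_tail_mass[OF S] block_sum_head_mass[OF S] sum_subtractf[symmetric]
    by (intro arg_cong[where f = abs] sum.cong refl)
      (simp add: right_diff_distrib diff_divide_distrib mult_ac)
  also have "\<dots> \<le> (\<Sum>j\<in>J. \<Sum>A\<in>Pow (S - {j}). \<bar>?c j A * (\<phi> A - \<phi> (insert j A))\<bar>)"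
    by (intro order.trans[OF sum_abs] sum_mono order.refl)
  also have "\<dots> \<le> (\<Sum>j\<in>J. \<Sum>A\<in>Pow (S - {j}). ?c j A * (e / ?Z A))"
    unfolding abs_mult abs_of_nonneg[OF c]
    by (intro sum_mono mult_left_mono lip c) auto
  also have "\<dots> = block_sum S (\<lambda>A. tail_mass J A * (e / ?Z A)) g (Suc h)"
    unfolding block_sum_tail_mass[OF S] by (simp add: mult_ac)
  also have "\<dots> \<le> block_sum S (\<lambda>A. e * 1) g (Suc h)"
  proof (intro block_sum_mono mult_right_mono g)
    fix A assume "A \<subseteq> S"
    have "tail_mass J A / ?Z A \<le> 1"
      using head_mass_nonneg[of J A] tail_mass_nonneg[of J A]
      by (intro divide_le_one_nonneg) auto
    from mult_left_mono[OF this e] show "tail_mass J A * (e / ?Z A) \<le> e * 1"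
      by (simp add: mult_ac)
  qed
  finally show ?thesis by (simp only: block_sum_cmult)
qed

text \<open>The exchange with \<open>\<phi>\<close> equal to \<open>1 / Z\<close> and to
  \<open>head_frac J A / Z\<close>, where \<open>Z\<close> is the total mass. With \<open>Y\<close>
  for \<open>head_frac\<close>, multiplication by tail and head mass gives \<open>1 - Y\<close> and
  \<open>Y\<close> in the first case, \<open>Y - Y\<^sup>2\<close> and \<open>Y\<^sup>2\<close> in
  the second.\<close>

lemma block_sum_head_frac:
  assumes g: "\<And>c. 0 \<le> g c" and S: "finite S" "J \<subseteq> S"
    and V: "0 < var_mass J"
  shows "\<bar>block_sum S (\<lambda>A. 1 - head_frac J A) g (Suc h) - block_sum S (head_frac J) g h\<bar>
      \<le> 1 / var_mass J * block_sum S (\<lambda>_. 1) g (Suc h)" (is ?A)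
    and "\<bar>block_sum S (\<lambda>A. head_frac J A - (head_frac J A)\<^sup>2) g (Suc h) -
        block_sum S (\<lambda>A. (head_frac J A)\<^sup>2) g h\<bar>
      \<le> 3 / var_mass J * block_sum S (\<lambda>_. 1) g (Suc h)" (is ?B)
proof -
  let ?Z = "\<lambda>A. head_mass J A + tail_mass J A"
  have fJ: "finite J" using S finite_subset by blast
  have Z: "0 < ?Z A" for A
    using var_mass_le[OF fJ, of A] V by linarith
  have t: "tail_mass J A / ?Z A = 1 - head_frac J A" for A
    using Z[of A] by (simp add: head_frac_def field_simps)
  have 1: "(\<lambda>A. 1 - head_frac J A) = (\<lambda>A. tail_mass J A * (1 / ?Z A))"
    "head_frac J = (\<lambda>A. head_mass J A * (1 / ?Z A))"
    unfolding t[symmetric] by (auto simp: head_frac_def)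
  have "head_frac J A - (head_frac J A)\<^sup>2 = head_frac J A * (1 - head_frac J A)" for A
    by (simp add: power2_eq_square algebra_simps)
  then have 2: "(\<lambda>A. head_frac J A - (head_frac J A)\<^sup>2) =
      (\<lambda>A. tail_mass J A * (head_frac J A / ?Z A))"
    "(\<lambda>A. (head_frac J A)\<^sup>2) = (\<lambda>A. head_mass J A * (head_frac J A / ?Z A))"
    unfolding t[symmetric] by (auto simp: head_frac_def power2_eq_square)
  have "\<bar>block_sum S (\<lambda>A. tail_mass J A * (1 / ?Z A)) g (Suc h) -
      block_sum S (\<lambda>A. head_mass J A * (1 / ?Z A)) g h\<bar>
      \<le> 1 / var_mass J * block_sum S (\<lambda>_. 1) g (Suc h)"
    using inverse_mass_insert(1)[OF fJ _ _ V] V by (intro block_sum_exchange[OF g S]) auto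
  then show ?A unfolding 1(1)[symmetric] 1(2)[symmetric] .
  have "\<bar>block_sum S (\<lambda>A. tail_mass J A * (head_frac J A / ?Z A)) g (Suc h) -
      block_sum S (\<lambda>A. head_mass J A * (head_frac J A / ?Z A)) g h\<bar>
      \<le> 3 / var_mass J * block_sum S (\<lambda>_. 1) g (Suc h)"
    using inverse_mass_insert(2)[OF fJ _ _ V] V by (intro block_sum_exchange[OF g S]) auto
  then show ?B unfolding 2(1)[symmetric] 2(2)[symmetric] .
qed

section \<open>Averages over continuations up to a level\<close>

abbreviation harm :: "(nat \<Rightarrow> nat \<Rightarrow> real) \<Rightarrow> bool" where
  "harm \<equiv> harmonic (\<lambda>h t. 1) (\<lambda>h t. a (h + t))"

text \<open>This is the function f_Y of the overview. Times are absolute, so one block statistic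
  serves all starting vertices. From a start on a level at most \<open>N\<close>, every segment ends
  at some \<open>c \<le> N\<close>, so \<open>N - c\<close> is a true difference, namely the second
  coordinate on level \<open>N\<close>.\<close>

definition level_avg ::
  "nat \<Rightarrow> (nat set \<Rightarrow> real) \<Rightarrow> (nat \<Rightarrow> nat \<Rightarrow> real) \<Rightarrow> nat \<Rightarrow> nat \<Rightarrow> real" where
  "level_avg N Y f h t = block_sum {h + t..<N} Y (\<lambda>c. f c (N - c)) h"

lemma harm_step: "harm f \<Longrightarrow> f h t = f (Suc h) t + a (h + t) * f h (Suc t)"
  unfolding harmonic_def mult_1 by blast

lemma level_avg_step:
  assumes "h + t < N" "\<And>A. Y (insert (h + t) A) = Y A"
  shows "level_avg N Y f h t = level_avg N Y f (Suc h) t + a (h + t) * level_avg N Y f h (Suc t)"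
proof -
  have "{h + t..<N} = insert (h + t) {Suc (h + t)..<N}" using assms(1) by auto
  then show ?thesis
    unfolding level_avg_def using assms(2) by (simp add: block_sum_insert)
qed

text \<open>Iterated harmonicity, by induction on the number of steps left before level
  \<open>N\<close>.\<close>

lemma level_avg_one:
  assumes "harm f" "h + t \<le> N"
  shows "level_avg N (\<lambda>_. 1) f h t = f h t"
  using assms(2)
proof (induction "N - (h + t)" arbitrary: h t)
  case 0
  then show ?case by (simp add: level_avg_def block_sum_def)
next
  case (Suc n)
  then have "level_avg N (\<lambda>_. 1) f (Suc h) t = f (Suc h) t"
    "level_avg N (\<lambda>_. 1) f h (Suc t) = f h (Suc t)" "h + t < N"
    by auto
  then show ?case using harm_step[OF assms(1), of h t] by (subst level_avg_step) auto
qed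

lemma level_avg_mono:
  assumes "\<And>A c. A \<subseteq> {h + t..<N} \<Longrightarrow> Y A * f c (N - c) \<le> Y' A * f' c (N - c)"
  shows "level_avg N Y f h t \<le> level_avg N Y' f' h t"
  unfolding level_avg_def by (intro block_sum_mono assms)

lemma level_avg_bounds:
  assumes "harm f" "h + t \<le> N" "\<And>A. 0 \<le> Y A" "\<And>A. Y A \<le> 1"
  shows "0 \<le> level_avg N Y f h t" "level_avg N Y f h t \<le> f h t"
proof -
  have "level_avg N (\<lambda>_. 0) f h t \<le> level_avg N Y f h t"
    using assms by (intro level_avg_mono) (simp add: harmonic_nonneg)
  then show "0 \<le> level_avg N Y f h t" by (simp add: level_avg_def block_sum_def)
  have "level_avg N Y f h t \<le> level_avg N (\<lambda>_. 1) f h t"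
    using assms by (intro level_avg_mono mult_right_mono harmonic_nonneg) auto
  then show "level_avg N Y f h t \<le> f h t" using assms by (simp add: level_avg_one)
qed

lemma head_frac_insert:
  assumes "n \<notin> J"
  shows "head_frac J (insert n A) = head_frac J A"
proof -
  have "J \<inter> insert n A = J \<inter> A" "J - insert n A = J - A" using assms by auto
  then show ?thesis by (simp only: head_frac_def head_mass_def tail_mass_def)
qed

text \<open>The condition \<open>h + t < k\<close> puts the swapped early step, at time
  \<open>h + t\<close>, before the block. Its two outcomes share the same remaining times, and these
  contain the whole block.\<close>

lemma level_avg_exchange:
  assumes f: "harm f" and k: "h + t < k" and V: "0 < var_mass {k..<N}"
  defines "Y \<equiv> head_frac {k..<N}"
  shows "\<bar>f (Suc h) t - level_avg N Y f (Suc h) t - level_avg N Y f h (Suc t)\<bar>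
      \<le> f (Suc h) t / var_mass {k..<N}"
    and "\<bar>level_avg N Y f (Suc h) t - level_avg N (\<lambda>A. (Y A)\<^sup>2) f (Suc h) t -
        level_avg N (\<lambda>A. (Y A)\<^sup>2) f h (Suc t)\<bar> \<le> 3 * f (Suc h) t / var_mass {k..<N}"
proof -
  have "k < N" using V by (cases "k < N") (auto simp: var_mass_def)
  then have 1: "level_avg N (\<lambda>_. 1) f (Suc h) t = f (Suc h) t"
    using k by (intro level_avg_one f) auto
  have S: "finite {Suc (h + t)..<N}" "{k..<N} \<subseteq> {Suc (h + t)..<N}" using k by auto
  have eq: "level_avg N Y' f (Suc h) t = block_sum {Suc (h + t)..<N} Y' (\<lambda>c. f c (N - c)) (Suc h)"
    "level_avg N Y' f h (Suc t) = block_sum {Suc (h + t)..<N} Y' (\<lambda>c. f c (N - c)) h" for Y'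
    by (simp_all add: level_avg_def)
  note E = block_sum_head_frac[where g = "\<lambda>c. f c (N - c)" and h = h, OF harmonic_nonneg[OF f] S V]
  have "level_avg N (\<lambda>A. 1 - Y A) f (Suc h) t = f (Suc h) t - level_avg N Y f (Suc h) t"
    unfolding 1[symmetric] unfolding level_avg_def by (rule block_sum_diff)
  then show "\<bar>f (Suc h) t - level_avg N Y f (Suc h) t - level_avg N Y f h (Suc t)\<bar>
      \<le> f (Suc h) t / var_mass {k..<N}"
    using E(1) unfolding Y_def eq[symmetric] 1 by simp
  have "level_avg N (\<lambda>A. Y A - (Y A)\<^sup>2) f (Suc h) t =
      level_avg N Y f (Suc h) t - level_avg N (\<lambda>A. (Y A)\<^sup>2) f (Suc h) t"
    unfolding level_avg_def by (rule block_sum_diff)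
  then show "\<bar>level_avg N Y f (Suc h) t - level_avg N (\<lambda>A. (Y A)\<^sup>2) f (Suc h) t -
        level_avg N (\<lambda>A. (Y A)\<^sup>2) f h (Suc t)\<bar> \<le> 3 * f (Suc h) t / var_mass {k..<N}"
    using E(2) unfolding Y_def eq[symmetric] 1 by simp
qed

end

section \<open>The harmonic functions of the laws with independent increments\<close>

context positive_sequence
begin

text \<open>The probability of a path divided by its weight: the factors \<open>a i\<close> of the
  vertical steps cancel. With \<open>0 ^ 0 = 1\<close> the formula also gives the function of the
  vertical path at \<open>\<theta> = 0\<close>.\<close>

definition indep_harm :: "real \<Rightarrow> nat \<Rightarrow> nat \<Rightarrow> real" where
  "indep_harm \<theta> h t = \<theta> ^ h / (\<Prod>i<h + t. \<theta> + a i)"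

definition all_heads_harm :: "nat \<Rightarrow> nat \<Rightarrow> real" where
  "all_heads_harm h t = (if t = 0 then 1 else 0)"

lemma prod_add_pos: "0 \<le> \<theta> \<Longrightarrow> 0 < (\<Prod>i<n. \<theta> + a i)"
  by (intro prod_pos) (auto intro: add_nonneg_pos a_pos)

lemma indep_harm_shift: "0 \<le> \<theta> \<Longrightarrow> indep_harm \<theta> (Suc h) t = \<theta> * indep_harm \<theta> h (Suc t)"
  by (simp add: indep_harm_def)

lemma indep_harm_split:
  assumes "0 \<le> \<theta>"
  shows "indep_harm \<theta> h t = (\<theta> + a (h + t)) * indep_harm \<theta> h (Suc t)"
  using add_nonneg_pos[OF assms a_pos[of "h + t"]] by (simp add: indep_harm_def)

lemma harm_indep_harm:
  assumes "0 \<le> \<theta>"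
  shows "harm (indep_harm \<theta>)"
  unfolding harmonic_def
proof (intro allI conjI)
  fix h t
  show "0 \<le> indep_harm \<theta> h t"
    unfolding indep_harm_def using assms less_imp_le[OF prod_add_pos[OF assms]] by simp
  show "indep_harm \<theta> h t = 1 * indep_harm \<theta> (Suc h) t + a (h + t) * indep_harm \<theta> h (Suc t)"
    unfolding indep_harm_shift[OF assms] using indep_harm_split[OF assms, of h t]
    by (simp add: distrib_right)
qed

lemma indep_harm_0: "indep_harm \<theta> 0 0 = 1"
  by (simp add: indep_harm_def)

text \<open>The shift relation turns harmonicity into a recursion in \<open>t\<close> with factor
  \<open>\<theta> + a (h + t)\<close>. This fixes \<open>f\<close> for \<open>h = 0\<close>, and the
  relation itself then carries the values to each next \<open>h\<close>.\<close>

lemma indep_harm_unique: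
  assumes "0 \<le> \<theta>" "harm f" "f 0 0 = 1" "\<And>h t. f (Suc h) t = \<theta> * f h (Suc t)"
  shows "f = indep_harm \<theta>"
proof -
  have split: "f h t = (\<theta> + a (h + t)) * f h (Suc t)" for h t
    using harm_step[OF assms(2), of h t] assms(4)[of h t] by (simp add: distrib_right)
  have "f h t = indep_harm \<theta> h t" for h t
  proof (induction h arbitrary: t)
    case 0
    show ?case
    proof (induction t)
      case 0
      then show ?case by (simp add: assms(3) indep_harm_0)
    next
      case (Suc t)
      then show ?case
        using split[of 0 t] indep_harm_split[OF assms(1), of 0 t] a_pos[of t] assms(1)
        by (simp add: add_nonneg_eq_0_iff less_imp_le)
    qed
  next
    case (Suc h)
    then show ?case using assms by (simp add: indep_harm_shift)
  qed
  then show ?thesis by blast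
qed

lemma harm_all_heads_harm: "harm all_heads_harm"
  by (simp add: harmonic_def all_heads_harm_def)

lemma all_heads_harm_unique:
  assumes "harm f" "f 0 0 = 1" "\<And>h t. f h (Suc t) = 0"
  shows "f = all_heads_harm"
proof -
  have step: "f (Suc h) 0 = f h 0" for h
    using harm_step[OF assms(1), of h 0] unfolding assms(3) by simp
  have "f h 0 = 1" for h
    by (induction h) (simp_all only: assms(2) step)
  then have "f h t = all_heads_harm h t" for h t
    using assms(3) by (cases t) (auto simp: all_heads_harm_def)
  then show ?thesis by blast
qed

text \<open>Both vertices have the same continuation patterns, and the shift relation applies at
  each endpoint, so it survives averaging with an arbitrary statistic.\<close>

lemma level_avg_indep_harm:
  assumes "0 \<le> \<theta>" "h + t < N"
  shows "level_avg N Y (indep_harm \<theta>) (Suc h) t = \<theta> * level_avg N Y (indep_harm \<theta>) h (Suc t)"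
proof -
  have "indep_harm \<theta> (Suc h + card A) (N - (Suc h + card A)) =
      \<theta> * indep_harm \<theta> (h + card A) (N - (h + card A))"
    if A: "A \<subseteq> {Suc (h + t)..<N}" for A
  proof -
    have "card A \<le> N - Suc (h + t)" using card_mono[OF _ A] by simp
    \<comment> \<open>The bound on \<open>card A\<close> guards against truncated subtraction: a
      segment from \<open>(h, Suc t)\<close> ends with a positive second coordinate.\<close>
    then have "Suc (N - Suc (h + card A)) = N - (h + card A)" using assms(2) by linarith
    then show ?thesis using indep_harm_shift[OF assms(1), of "h + card A" "N - Suc (h + card A)"] by simp
  qed
  then show ?thesis
    unfolding level_avg_def block_sum_def sum_distrib_left by (intro sum.cong) auto
qed

text \<open>With positive weights, a zero of a nonnegative harmonic function spreads to both
  successors. This settles the boundary ratios 0 and 1, where no proper convex combination is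
  available.\<close>

lemma zero_harm:
  assumes "harm F" "F 0 0 = 0"
  shows "F h t = 0"
proof -
  have *: "F (Suc h) t = 0 \<and> F h (Suc t) = 0" if "F h t = 0" for h t
    using harm_step[OF assms(1), of h t] harmonic_nonneg[OF assms(1), of "Suc h" t]
      harmonic_nonneg[OF assms(1), of h "Suc t"] a_pos[of "h + t"] that
    by (simp add: add_nonneg_eq_0_iff less_imp_le)
  have "F h 0 = 0" for h by (induction h) (use assms(2) * in auto)
  then show ?thesis by (induction t) (use * in auto)
qed

text \<open>A walk uses one coin per level; the vertex visited at time \<open>n\<close> has level
  \<open>n\<close>.\<close>

lemma walk_eq_coin_path: "walk b = coin_path (\<lambda>v. b (fst v + snd v))"
proof
  fix n
  show "walk b n = coin_path (\<lambda>v. b (fst v + snd v)) n"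
  proof (induction n)
    case 0
    show ?case by (simp add: walk_def zero_prod_def)
  next
    case (Suc n)
    have "walk b (Suc n) = walk b n + step (b n)" by (simp add: walk_def)
    then show ?case
      using Suc infinite_path_level[OF coin_path_infinite[of "\<lambda>v. b (fst v + snd v)"], of n] by simp
  qed
qed

lemma indep_law_represented:
  assumes \<theta>: "0 < \<theta>"
  shows "represents (\<lambda>h t. 1) (\<lambda>h t. a (h + t)) (indep_law a \<theta>) (indep_harm \<theta>)"
proof -
  define B where "B n = bernoulli_pmf (\<theta> / (\<theta> + a n))" for n
  let ?M = "\<Pi>\<^sub>M n\<in>UNIV. measure_pmf (B n)"
  have law: "indep_law a \<theta> = distr ?M path_space walk"
    by (simp add: indep_law_def B_def)
  have m: "walk \<in> measurable ?M path_space" by (rule measurable_walk) simp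
  \<comment> \<open>The transition probability of the Doob transform depends on the level only,
    which is why the increments are independent.\<close>
  have rp: "right_prob (indep_harm \<theta>) v = \<theta> / (\<theta> + a (fst v + snd v))" for v
  proof -
    obtain h t where v: "v = (h, t)" by fastforce
    have "0 < indep_harm \<theta> h (Suc t)"
      unfolding indep_harm_def using \<theta> by (intro divide_pos_pos prod_add_pos) simp_all
    then show ?thesis
      unfolding right_prob_def v fst_conv snd_conv indep_harm_shift[OF less_imp_le[OF \<theta>]]
        indep_harm_split[OF less_imp_le[OF \<theta>], of h t]
      by simp
  qed
  have "measure (indep_law a \<theta>) (cylinder p) =
      path_weight (\<lambda>h t. 1) (\<lambda>h t. a (h + t)) p * indep_harm \<theta> (fst (last p)) (snd (last p))"
    if p: "standard_path p" for p
  proof -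
    have lev: "fst (p ! i) + snd (p ! i) = i" if "i < length p - 1" for i
      using that by (intro standard_path_nth_sum[OF p]) simp
    have "measure (indep_law a \<theta>) (cylinder p) = measure ?M (walk -` cylinder p \<inter> space ?M)"
      unfolding law using p by (intro measure_distr m cylinder_sets)
    also have "walk -` cylinder p \<inter> space ?M = {b. \<forall>i\<in>{..<length p - 1}. b i = turns_right p i}"
      by (auto simp: space_PiM walk_eq_coin_path coin_path_cylinder[OF p] lev)
    also have "measure ?M \<dots> = (\<Prod>i<length p - 1. pmf (B i) (turns_right p i))"
      by (rule measure_PiM_pmf) simp
    also have "\<dots> = (\<Prod>i<length p - 1.
        pmf (bernoulli_pmf (right_prob (indep_harm \<theta>) (p ! i))) (turns_right p i))"
      by (intro prod.cong) (auto simp: rp B_def lev)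
    also have "\<dots> = path_weight (\<lambda>h t. 1) (\<lambda>h t. a (h + t)) p *
        indep_harm \<theta> (fst (last p)) (snd (last p))"
      using \<theta> by (intro path_weight_harmonic[symmetric] p harm_indep_harm indep_harm_0) simp
    finally show ?thesis .
  qed
  then show ?thesis
    unfolding represents_def using prob_space_indep_law[of a \<theta>] by (simp add: indep_law_def)
qed

end

section \<open>Extreme harmonic functions under divergence\<close>

text \<open>Block \<open>k\<close> consists of the times from \<open>k\<close> to
  \<open>N k - 1\<close>. Starting at \<open>k\<close> puts every fixed vertex eventually before the
  block, and the summand 1 keeps the mass positive even for \<open>k = 0\<close>.\<close>

locale divergent_sequence = positive_sequence +
  fixes N :: "nat \<Rightarrow> nat"
  assumes N: "real k + 1 \<le> var_mass {k..<N k}"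
begin

abbreviation Y :: "nat \<Rightarrow> nat set \<Rightarrow> real" where
  "Y k \<equiv> head_frac {k..<N k}"

lemma var_mass_N_pos: "0 < var_mass {k..<N k}"
  using N[of k] by linarith

lemma less_N: "k < N k"
  using var_mass_N_pos[of k] by (cases "k < N k") (auto simp: var_mass_def)

lemma over_var_mass_tendsto: "(\<lambda>k. c / var_mass {k..<N k}) \<longlonglongrightarrow> 0"
proof (rule real_tendsto_divide_at_top[OF tendsto_const])
  show "filterlim (\<lambda>k. var_mass {k..<N k}) at_top sequentially"
  proof (rule filterlim_at_top_mono[OF filterlim_real_sequentially always_eventually])
    show "\<forall>k. real k \<le> var_mass {k..<N k}"
    proof
      fix k show "real k \<le> var_mass {k..<N k}" using N[of k] by linarith
    qed
  qed
qed

lemma exchange_tendsto: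
  assumes f: "harm f"
  shows "(\<lambda>k. f (Suc h) t - level_avg (N k) (Y k) f (Suc h) t
      - level_avg (N k) (Y k) f h (Suc t)) \<longlonglongrightarrow> 0"
    and "(\<lambda>k. level_avg (N k) (Y k) f (Suc h) t
      - level_avg (N k) (\<lambda>A. (Y k A)\<^sup>2) f (Suc h) t
      - level_avg (N k) (\<lambda>A. (Y k A)\<^sup>2) f h (Suc t)) \<longlonglongrightarrow> 0"
proof -
  have ev: "eventually (\<lambda>k. h + t < k) sequentially" by (rule eventually_gt_at_top)
  show "(\<lambda>k. f (Suc h) t - level_avg (N k) (Y k) f (Suc h) t
      - level_avg (N k) (Y k) f h (Suc t)) \<longlonglongrightarrow> 0"
    by (rule Lim_null_comparison[OF _ over_var_mass_tendsto[of "f (Suc h) t"]])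
      (use eventually_mono[OF ev level_avg_exchange(1)[OF f _ var_mass_N_pos]] in simp)
  show "(\<lambda>k. level_avg (N k) (Y k) f (Suc h) t
      - level_avg (N k) (\<lambda>A. (Y k A)\<^sup>2) f (Suc h) t
      - level_avg (N k) (\<lambda>A. (Y k A)\<^sup>2) f h (Suc t)) \<longlonglongrightarrow> 0"
    by (rule Lim_null_comparison[OF _ over_var_mass_tendsto[of "3 * f (Suc h) t"]])
      (use eventually_mono[OF ev level_avg_exchange(2)[OF f _ var_mass_N_pos]] in simp)
qed

section \<open>Concentration of the block statistic under independent increments\<close>

lemma level_avg_square_tendsto:
  assumes \<theta>: "0 \<le> \<theta>"
  defines "y \<equiv> \<theta> / (1 + \<theta>)"
  shows "(\<lambda>k. level_avg (N k) (\<lambda>A. (Y k A - y)\<^sup>2) (indep_harm \<theta>) h (Suc t)) \<longlonglongrightarrow> 0"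
proof -
  let ?f = "indep_harm \<theta>"
  let ?L = "?f h (Suc t)"
  let ?x = "\<lambda>k. level_avg (N k) (Y k) ?f h (Suc t)"
  let ?z = "\<lambda>k. level_avg (N k) (\<lambda>A. (Y k A)\<^sup>2) ?f h (Suc t)"
  have f: "harm ?f" by (rule harm_indep_harm[OF \<theta>])
  have th: "0 < 1 + \<theta>" using \<theta> by simp
  have ev: "eventually (\<lambda>k. h + t < N k) sequentially"
    by (rule eventually_mono[OF eventually_gt_at_top[of "h + t"]]) (use less_N in \<open>auto intro: less_trans\<close>)
  have "(\<lambda>k. \<theta> * ?L - \<theta> * ?x k - ?x k) \<longlonglongrightarrow> 0"
    using exchange_tendsto(1)[OF f, of h t]
    by (rule Lim_transform_eventually)
      (use ev in eventually_elim, simp add: level_avg_indep_harm[OF \<theta>] indep_harm_shift[OF \<theta>])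
  \<comment> \<open>The exchange limit, a linear equation thanks to the shift relation, is solved
    for the mean: subtracting the null sequence from \<open>\<theta> * ?L\<close> leaves
    \<open>(1 + \<theta>) * ?x k\<close>.\<close>
  from tendsto_divide[OF tendsto_diff[OF tendsto_const this] tendsto_const, of "1 + \<theta>" "\<theta> * ?L"]
  have x: "?x \<longlonglongrightarrow> y * ?L"
    using th unfolding y_def by (auto elim!: back_subst[of "\<lambda>g. g \<longlonglongrightarrow> _"] simp: fun_eq_iff field_simps)
  have "(\<lambda>k. \<theta> * ?x k - \<theta> * ?z k - ?z k) \<longlonglongrightarrow> 0"
    using exchange_tendsto(2)[OF f, of h t]
    by (rule Lim_transform_eventually)
      (use ev in eventually_elim, simp add: level_avg_indep_harm[OF \<theta>])
  \<comment> \<open>Likewise the second moment tends to \<open>\<theta> / (1 + \<theta>)\<close>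
    times the limit of the mean, hence to \<open>y\<^sup>2 * ?L\<close>, and the variance vanishes
    in the limit.\<close>
  from tendsto_divide[OF tendsto_diff[OF tendsto_mult[OF tendsto_const x] this] tendsto_const, of "1 + \<theta>" \<theta>]
  have z: "?z \<longlonglongrightarrow> y\<^sup>2 * ?L"
    using th unfolding y_def
    by (auto elim!: back_subst[of "\<lambda>g. g \<longlonglongrightarrow> _"] simp: fun_eq_iff field_simps power2_eq_square)
  have "level_avg (N k) (\<lambda>A. (Y k A - y)\<^sup>2) ?f h (Suc t) = ?z k - 2 * y * ?x k + y\<^sup>2 * ?L"
    if "h + t < N k" for k
  proof -
    have "level_avg (N k) (\<lambda>A. (Y k A - y)\<^sup>2) ?f h (Suc t) =
        level_avg (N k) (\<lambda>A. (Y k A)\<^sup>2 - (2 * y) * Y k A + y\<^sup>2 * 1) ?f h (Suc t)"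
      by (rule arg_cong[where f = "\<lambda>Y. level_avg (N k) Y ?f h (Suc t)"])
        (simp add: fun_eq_iff power2_diff)
    also have "\<dots> = ?z k - 2 * y * ?x k + y\<^sup>2 * level_avg (N k) (\<lambda>_. 1) ?f h (Suc t)"
      unfolding level_avg_def by (simp only: block_sum_add block_sum_diff block_sum_cmult)
    finally show ?thesis using that by (simp add: level_avg_one[OF f])
  qed
  then have "h + t < N k \<Longrightarrow> ?z k - 2 * y * ?x k + y\<^sup>2 * ?L =
      level_avg (N k) (\<lambda>A. (Y k A - y)\<^sup>2) ?f h (Suc t)" for k
    by simp
  then have ev': "eventually (\<lambda>k. ?z k - 2 * y * ?x k + y\<^sup>2 * ?L =
      level_avg (N k) (\<lambda>A. (Y k A - y)\<^sup>2) ?f h (Suc t)) sequentially"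
    by (rule eventually_mono[OF ev])
  have "(\<lambda>k. ?z k - 2 * y * ?x k + y\<^sup>2 * ?L) \<longlonglongrightarrow> y\<^sup>2 * ?L - 2 * y * (y * ?L) + y\<^sup>2 * ?L"
    by (intro tendsto_intros x z)
  also have "y\<^sup>2 * ?L - 2 * y * (y * ?L) + y\<^sup>2 * ?L = 0" by (simp add: power2_eq_square)
  finally show ?thesis by (rule Lim_transform_eventually) (rule ev')
qed

text \<open>From \<open>\<bar>x\<bar> \<le> d + x\<^sup>2 / d\<close> with
  \<open>x = Y k A - y\<close>: the first term is averaged with \<open>f\<close> and costs
  \<open>d * f h t\<close>, the second is averaged with \<open>C * indep_harm \<theta>\<close> and
  tends to 0 for fixed \<open>d\<close>.\<close>

lemma level_avg_dominated_tendsto: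
  assumes \<theta>: "0 \<le> \<theta>" and f: "harm f" and C: "\<And>h t. f h t \<le> C * indep_harm \<theta> h t"
  defines "y \<equiv> \<theta> / (1 + \<theta>)"
  assumes sq: "(\<lambda>k. level_avg (N k) (\<lambda>A. (Y k A - y)\<^sup>2) (indep_harm \<theta>) h t) \<longlonglongrightarrow> 0"
  shows "(\<lambda>k. level_avg (N k) (Y k) f h t) \<longlonglongrightarrow> y * f h t"
proof -
  let ?M = "\<lambda>k. level_avg (N k) (\<lambda>A. (Y k A - y)\<^sup>2) (indep_harm \<theta>) h t"
  have bound: "\<bar>level_avg (N k) (Y k) f h t - y * f h t\<bar> \<le> d * f h t + C / d * ?M k"
    if d: "0 < d" and k: "h + t \<le> N k" for d k
  proof -
    have amgm: "\<bar>x\<bar> \<le> d + x\<^sup>2 / d" for x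
    proof -
      have "0 \<le> (\<bar>x\<bar> - d)\<^sup>2 + d * \<bar>x\<bar>" using d by simp
      then have "\<bar>x\<bar> * d \<le> d\<^sup>2 + x\<^sup>2" by (simp add: power2_diff algebra_simps)
      then show ?thesis using d by (simp add: field_simps power2_eq_square)
    qed
    have ineq: "\<bar>x\<bar> * f c (N k - c) \<le> d * f c (N k - c) + C / d * (x\<^sup>2 * indep_harm \<theta> c (N k - c))" for x c
    proof -
      have "\<bar>x\<bar> * f c (N k - c) \<le> (d + x\<^sup>2 / d) * f c (N k - c)"
        by (intro mult_right_mono amgm harmonic_nonneg f)
      moreover have "x\<^sup>2 / d * f c (N k - c) \<le> x\<^sup>2 / d * (C * indep_harm \<theta> c (N k - c))"
        using d by (intro mult_left_mono C) auto
      ultimately show ?thesis by (simp add: algebra_simps)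
    qed
    \<comment> \<open>The signs \<open>s = 1\<close> and \<open>s = -1\<close> together bound the
      absolute value. Factors \<open>* 1\<close> below present constants as multiples of the
      constant statistic 1, whose average is \<open>f h t\<close>.\<close>
    have *: "level_avg (N k) (\<lambda>A. s * (Y k A - y)) f h t \<le> d * f h t + C / d * ?M k"
      if s: "\<bar>s\<bar> = 1" for s
    proof -
      have "level_avg (N k) (\<lambda>A. s * (Y k A - y) - d * 1) f h t \<le>
          level_avg (N k) (\<lambda>A. C / d * (Y k A - y)\<^sup>2) (indep_harm \<theta>) h t"
      proof (rule level_avg_mono)
        fix A c
        have "s * (Y k A - y) \<le> \<bar>Y k A - y\<bar>"
          using s by (metis abs_ge_self abs_mult mult_1)
        then have "s * (Y k A - y) * f c (N k - c) \<le> \<bar>Y k A - y\<bar> * f c (N k - c)"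
          by (intro mult_right_mono harmonic_nonneg f)
        then show "(s * (Y k A - y) - d * 1) * f c (N k - c) \<le>
            C / d * (Y k A - y)\<^sup>2 * indep_harm \<theta> c (N k - c)"
          using ineq[of "Y k A - y" c] by (simp add: left_diff_distrib mult.assoc)
      qed
      then show ?thesis
        using level_avg_one[OF f k]
        unfolding level_avg_def block_sum_diff block_sum_cmult by simp
    qed
    have "level_avg (N k) (\<lambda>A. s * (Y k A - y * 1)) f h t =
        s * (level_avg (N k) (Y k) f h t - y * f h t)" for s
      using level_avg_one[OF f k]
      unfolding level_avg_def block_sum_diff block_sum_cmult by simp
    from this[of 1] this[of "-1"] *[of 1] *[of "-1"] show ?thesis by simp
  qed
  show ?thesis
  proof (rule LIMSEQ_I)
    fix e :: real assume e: "0 < e"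
    \<comment> \<open>Chosen so that \<open>d * f h t \<le> e / 2\<close>; the added 1 covers
      \<open>f h t = 0\<close>.\<close>
    define d where "d = e / (2 * (1 + f h t))"
    have f0: "0 \<le> f h t" by (rule harmonic_nonneg[OF f])
    then have d: "0 < d" using e by (simp add: d_def)
    have "d * f h t = e / 2 * (f h t / (1 + f h t))" by (simp add: d_def)
    also have "\<dots> \<le> e / 2 * 1" using e f0 by (intro mult_left_mono) auto
    finally have df: "d * f h t \<le> e / 2" by simp
    have "(\<lambda>k. C / d * ?M k) \<longlonglongrightarrow> 0"
      using tendsto_mult_left[OF sq, of "C / d"] by (simp only: mult_zero_right)
    then have "eventually (\<lambda>k. C / d * ?M k < e / 2) sequentially"
      using e by (intro order_tendstoD(2)) auto
    moreover have "eventually (\<lambda>k. h + t \<le> N k) sequentially"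
      by (rule eventually_mono[OF eventually_ge_at_top[of "h + t"]])
        (use less_N in \<open>auto intro: order_trans less_imp_le\<close>)
    ultimately have "eventually (\<lambda>k. norm (level_avg (N k) (Y k) f h t - y * f h t) < e) sequentially"
    proof eventually_elim
      case (elim k)
      then show ?case using bound[OF d, of k] df unfolding real_norm_def by linarith
    qed
    then show "\<exists>no. \<forall>n\<ge>no. norm (level_avg (N n) (Y n) f h t - y * f h t) < e"
      by (simp add: eventually_sequentially)
  qed
qed

text \<open>For \<open>f\<close> too the statistic acts in the limit as the constant
  \<open>y\<close>, so the exchange limit reads
  \<open>f (Suc h) t = y * (f (Suc h) t + f h (Suc t))\<close>. This is the shift relation that
  characterises \<open>indep_harm \<theta>\<close>.\<close>

lemma harm_dominated_by_indep_harm: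
  assumes \<theta>: "0 \<le> \<theta>" and f: "harm f" "f 0 0 = 1"
    and C: "\<And>h t. f h t \<le> C * indep_harm \<theta> h t"
  shows "f = indep_harm \<theta>"
proof (rule indep_harm_unique[OF \<theta> f])
  fix h t
  define y where "y = \<theta> / (1 + \<theta>)"
  have th: "0 < 1 + \<theta>" using \<theta> by simp
  note sq = level_avg_square_tendsto[OF \<theta>, of h t, folded y_def]
  have 1: "(\<lambda>k. level_avg (N k) (Y k) f h (Suc t)) \<longlonglongrightarrow> y * f h (Suc t)"
    unfolding y_def by (rule level_avg_dominated_tendsto[OF \<theta> f(1) C sq[unfolded y_def]])
  have ev: "eventually (\<lambda>k. h + t < N k) sequentially"
    by (rule eventually_mono[OF eventually_gt_at_top[of "h + t"]]) (use less_N in \<open>auto intro: less_trans\<close>)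
  have "(\<lambda>k. level_avg (N k) (\<lambda>A. (Y k A - y)\<^sup>2) (indep_harm \<theta>) (Suc h) t) \<longlonglongrightarrow> \<theta> * 0"
    by (rule Lim_transform_eventually[OF tendsto_mult_left[OF sq]])
      (use ev in eventually_elim, simp add: level_avg_indep_harm[OF \<theta>])
  then have sq': "(\<lambda>k. level_avg (N k) (\<lambda>A. (Y k A - y)\<^sup>2) (indep_harm \<theta>) (Suc h) t) \<longlonglongrightarrow> 0"
    by simp
  have 2: "(\<lambda>k. level_avg (N k) (Y k) f (Suc h) t) \<longlonglongrightarrow> y * f (Suc h) t"
    unfolding y_def by (rule level_avg_dominated_tendsto[OF \<theta> f(1) C sq'[unfolded y_def]])
  have "(\<lambda>k. f (Suc h) t - level_avg (N k) (Y k) f (Suc h) t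
      - level_avg (N k) (Y k) f h (Suc t)) \<longlonglongrightarrow> f (Suc h) t - y * f (Suc h) t - y * f h (Suc t)"
    by (intro tendsto_intros 1 2)
  from LIMSEQ_unique[OF this exchange_tendsto(1)[OF f(1)]]
  have "0 = (f (Suc h) t - y * f (Suc h) t - y * f h (Suc t)) * (1 + \<theta>)"
    by simp
  also have "\<dots> = f (Suc h) t * (1 + \<theta>) - (y * (1 + \<theta>)) * (f (Suc h) t + f h (Suc t))"
    by (simp add: algebra_simps)
  also have "y * (1 + \<theta>) = \<theta>" using th by (simp add: y_def)
  finally show "f (Suc h) t = \<theta> * f h (Suc t)"
    by (simp add: algebra_simps)
qed

section \<open>Compactness, and the ratio relation of an extreme harmonic function\<close>

lemma level_avg_convergent_subseq:
  assumes f: "harm f"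
  obtains r L where "strict_mono (r :: nat \<Rightarrow> nat)"
    "\<And>h t. (\<lambda>k. level_avg (N (r k)) (Y (r k)) f h t) \<longlonglongrightarrow> L h t"
proof -
  let ?F = "\<lambda>k h t. level_avg (N k) (Y k) f h t"
  \<comment> \<open>Diagonal extraction over the countably many vertices needs one common bound;
    division by \<open>1 + f\<close> gives the bound 1. The values 0 replace the finitely many
    \<open>k\<close> for which \<open>v\<close> might lie beyond level \<open>N k\<close>.\<close>
  define G where "G k v = (if fst v + snd v \<le> k
    then ?F k (fst v) (snd v) / (1 + f (fst v) (snd v)) else 0)" for k v
  have bound: "norm (G k v) \<le> 1" for k v
  proof (cases "fst v + snd v \<le> k")
    case True
    then have "fst v + snd v \<le> N k" using less_N[of k] by simp
    then have "0 \<le> ?F k (fst v) (snd v)" "?F k (fst v) (snd v) \<le> f (fst v) (snd v)"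
      by (rule level_avg_bounds[OF f _ head_frac_bounds])+
    then show ?thesis using True by (simp add: G_def divide_le_eq)
  qed (simp add: G_def)
  obtain r where r: "strict_mono (r :: nat \<Rightarrow> nat)" "\<And>v. \<exists>l. (\<lambda>k. G (r k) v) \<longlonglongrightarrow> l"
  proof (rule function_convergent_subsequence[of "UNIV :: (nat \<times> nat) set" G 1, OF countableI_type bound])
    fix r :: "nat \<Rightarrow> nat"
    assume r: "strict_mono r" and l: "\<And>v. v \<in> UNIV \<Longrightarrow> \<exists>l. (\<lambda>k. G (r k) v) \<longlonglongrightarrow> l"
    show thesis by (rule that[OF r l[OF UNIV_I]])
  qed
  then obtain l where l: "\<And>v. (\<lambda>k. G (r k) v) \<longlonglongrightarrow> l v" by metis
  have "(\<lambda>k. ?F (r k) h t) \<longlonglongrightarrow> l (h, t) * (1 + f h t)" for h t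
  proof (rule Lim_transform_eventually)
    show "(\<lambda>k. G (r k) (h, t) * (1 + f h t)) \<longlonglongrightarrow> l (h, t) * (1 + f h t)"
      by (intro tendsto_intros l)
    have "G (r k) (h, t) * (1 + f h t) = ?F (r k) h t" if "h + t \<le> k" for k
    proof -
      have "h + t \<le> r k" using that seq_suble[OF r(1), of k] by simp
      then show ?thesis using harmonic_nonneg[OF f, of h t] by (simp add: G_def)
    qed
    then show "eventually (\<lambda>k. G (r k) (h, t) * (1 + f h t) = ?F (r k) h t) sequentially"
      by (rule eventually_mono[OF eventually_ge_at_top[of "h + t"]])
  qed
  then show ?thesis using that[of r "\<lambda>h t. l (h, t) * (1 + f h t)"] r(1) by blast
qed

text \<open>The limit \<open>L\<close> of the averages and the remainder \<open>f - L\<close> are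
  both nonnegative and harmonic, so after normalisation they decompose \<open>f\<close>. Extremality
  forces \<open>L = y * f\<close> with \<open>y = L 0 0\<close>, and the exchange limit becomes the
  ratio relation.\<close>

lemma extreme_harm_ratio:
  assumes f: "harm f" "f 0 0 = 1"
    and ext: "extreme_harmonic (\<lambda>h t. 1) (\<lambda>h t. a (h + t)) f"
  shows "\<exists>y. 0 \<le> y \<and> y \<le> 1 \<and> (\<forall>h t. (1 - y) * f (Suc h) t = y * f h (Suc t))"
proof -
  let ?F = "\<lambda>k h t. level_avg (N k) (Y k) f h t"
  obtain r L where r: "strict_mono (r :: nat \<Rightarrow> nat)"
    and L: "\<And>h t. (\<lambda>k. ?F (r k) h t) \<longlonglongrightarrow> L h t"
    using level_avg_convergent_subseq[OF f(1)] by blast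
  have ge: "h + t < r k" if "h + t < k" for h t k
    using that seq_suble[OF r, of k] by simp
  have bounds: "0 \<le> ?F (r k) h t" "?F (r k) h t \<le> f h t" if "h + t < k" for h t k
  proof -
    have "h + t \<le> N (r k)" using ge[OF that] less_N[of "r k"] by simp
    then show "0 \<le> ?F (r k) h t" "?F (r k) h t \<le> f h t"
      by (rule level_avg_bounds[OF f(1) _ head_frac_bounds])+
  qed
  have ev: "eventually (\<lambda>k. h + t < k) sequentially" for h t by (rule eventually_gt_at_top)
  have L0: "0 \<le> L h t" for h t
    by (rule tendsto_lowerbound[OF L eventually_mono[OF ev]]) (use bounds in auto)
  have Lf: "L h t \<le> f h t" for h t
    by (rule tendsto_upperbound[OF L eventually_mono[OF ev]]) (use bounds in auto)
  have Ls: "L h t = L (Suc h) t + a (h + t) * L h (Suc t)" for h t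
  proof (rule LIMSEQ_unique)
    show "(\<lambda>k. ?F (r k) h t) \<longlonglongrightarrow> L h t" by (rule L)
    have "?F (r k) (Suc h) t + a (h + t) * ?F (r k) h (Suc t) = ?F (r k) h t" if k: "h + t < k" for k
      using ge[OF k] less_N[of "r k"] by (intro level_avg_step[symmetric] head_frac_insert) auto
    then have "eventually (\<lambda>k. ?F (r k) (Suc h) t + a (h + t) * ?F (r k) h (Suc t) = ?F (r k) h t)
        sequentially"
      by (rule eventually_mono[OF ev])
    moreover have "(\<lambda>k. ?F (r k) (Suc h) t + a (h + t) * ?F (r k) h (Suc t)) \<longlonglongrightarrow>
        L (Suc h) t + a (h + t) * L h (Suc t)"
      by (intro tendsto_intros L)
    ultimately show "(\<lambda>k. ?F (r k) h t) \<longlonglongrightarrow> L (Suc h) t + a (h + t) * L h (Suc t)"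
      by (rule Lim_transform_eventually[rotated])
  qed
  define D where "D h t = f h t - L h t" for h t
  have Ds: "D h t = D (Suc h) t + a (h + t) * D h (Suc t)" for h t
    unfolding D_def using Ls[of h t] harm_step[OF f(1), of h t] by (simp add: right_diff_distrib)
  have scaled: "harm (\<lambda>h t. c * M h t)"
    if "0 \<le> c" "\<And>h t. 0 \<le> M h t" "\<And>h t. M h t = M (Suc h) t + a (h + t) * M h (Suc t)" for c M
    unfolding harmonic_def
  proof (intro allI conjI)
    fix h t
    show "0 \<le> c * M h t" using that(1,2) by simp
    show "c * M h t = 1 * (c * M (Suc h) t) + a (h + t) * (c * M h (Suc t))"
      by (subst that(3)) (simp add: algebra_simps)
  qed
  have D0: "0 \<le> D h t" for h t using Lf by (simp add: D_def)
  define y where "y = L 0 0"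
  have y: "0 \<le> y" "y \<le> 1" using L0[of 0 0] Lf[of 0 0] f(2) by (simp_all add: y_def)
  have Ly: "L h t = y * f h t" for h t
  proof -
    consider "y = 0" | "y = 1" | "0 < y" "y < 1" using y by linarith
    then show ?thesis
    proof cases
      case 1
      have "harm L" using scaled[of 1 L, OF _ L0 Ls] by simp
      then show ?thesis using zero_harm[of L] 1 y_def by simp
    next
      case 2
      have "harm D" using scaled[of 1 D, OF _ D0 Ds] by simp
      moreover have "D 0 0 = 0" using 2 f(2) by (simp add: D_def y_def)
      ultimately have "D h t = 0" using zero_harm[of D] by blast
      then show ?thesis using 2 by (simp add: D_def)
    next
      case 3
      have "(\<lambda>h t. 1 / y * L h t) = (\<lambda>h t. 1 / (1 - y) * D h t)"
      \<comment> \<open>The coefficient \<open>u\<close> belongs to the second function, here the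
        remainder, so \<open>u = 1 - y\<close>.\<close>
      proof (rule extreme_harmonicD[OF ext])
        show "harm (\<lambda>h t. 1 / y * L h t)"
          by (rule scaled[of "1 / y" L, OF _ L0 Ls]) (use 3 in simp)
        show "harm (\<lambda>h t. 1 / (1 - y) * D h t)"
          by (rule scaled[of "1 / (1 - y)" D, OF _ D0 Ds]) (use 3 in simp)
        show "1 / y * L 0 0 = 1" "1 / (1 - y) * D 0 0 = 1" "0 < 1 - y" "1 - y < 1"
          using 3 f(2) by (simp_all add: y_def D_def)
        show "f h t = (1 - (1 - y)) * (1 / y * L h t) + (1 - y) * (1 / (1 - y) * D h t)" for h t
          using 3 by (simp add: D_def)
      qed
      then have "1 / y * L h t = 1 / (1 - y) * D h t" by meson
      then have "(1 - y) * L h t = y * D h t" using 3 by (simp add: field_simps)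
      then show ?thesis by (simp add: D_def algebra_simps)
    qed
  qed
  have "(1 - y) * f (Suc h) t = y * f h (Suc t)" for h t
  proof -
    have "(\<lambda>k. f (Suc h) t - ?F (r k) (Suc h) t - ?F (r k) h (Suc t)) \<longlonglongrightarrow>
        f (Suc h) t - y * f (Suc h) t - y * f h (Suc t)"
      unfolding Ly[symmetric] by (intro tendsto_intros L)
    moreover have "(\<lambda>k. f (Suc h) t - ?F (r k) (Suc h) t - ?F (r k) h (Suc t)) \<longlonglongrightarrow> 0"
      using LIMSEQ_subseq_LIMSEQ[OF exchange_tendsto(1)[OF f(1), of h t] r] by (simp add: o_def)
    ultimately have "f (Suc h) t - y * f (Suc h) t - y * f h (Suc t) = 0" by (rule LIMSEQ_unique)
    then show ?thesis by (simp add: algebra_simps)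
  qed
  then show ?thesis using y by blast
qed

section \<open>The extreme harmonic functions and their laws\<close>

definition theta_harm :: "ennreal \<Rightarrow> nat \<Rightarrow> nat \<Rightarrow> real" where
  "theta_harm \<theta> = (if \<theta> = \<infinity> then all_heads_harm else indep_harm (enn2real \<theta>))"

text \<open>Each part of a decomposition is dominated by a multiple of
  \<open>theta_harm \<theta>\<close>. A normalised harmonic function dominated in this way must
  equal it, so the two parts coincide.\<close>

lemma theta_harm_extreme: "extreme_harmonic (\<lambda>h t. 1) (\<lambda>h t. a (h + t)) (theta_harm \<theta>)"
  unfolding extreme_harmonic_def
proof (intro allI impI, elim conjE)
  fix g k and u :: real
  assume g: "harm g" "g 0 0 = 1" and k: "harm k" "k 0 0 = 1" and u: "0 < u" "u < 1"
    and eq: "\<forall>h t. theta_harm \<theta> h t = (1 - u) * g h t + u * k h t"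
  have unique: "m = theta_harm \<theta>"
    if m: "harm m" "m 0 0 = 1" and le: "\<And>h t. c * m h t \<le> theta_harm \<theta> h t" and c: "0 < c" for m c
  proof (cases "\<theta> = \<infinity>")
    case True
    have "m h (Suc t) = 0" for h t
    proof -
      have "c * m h (Suc t) \<le> 0"
        using le[of h "Suc t"] True by (simp add: theta_harm_def all_heads_harm_def)
      then have "m h (Suc t) \<le> 0" using c by (simp add: mult_le_0_iff)
      then show ?thesis using harmonic_nonneg[OF m(1), of h "Suc t"] by simp
    qed
    then show ?thesis using all_heads_harm_unique[OF m] True by (simp add: theta_harm_def)
  next
    case False
    have "m h t \<le> 1 / c * indep_harm (enn2real \<theta>) h t" for h t
      using le[of h t] c False by (simp add: theta_harm_def field_simps)
    then have "m = indep_harm (enn2real \<theta>)"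
      by (rule harm_dominated_by_indep_harm[OF enn2real_nonneg m])
    then show ?thesis using False by (simp add: theta_harm_def)
  qed
  have "g = theta_harm \<theta>"
    by (rule unique[OF g, of "1 - u"]) (use u eq harmonic_nonneg[OF k(1)] in auto)
  moreover have "k = theta_harm \<theta>"
    by (rule unique[OF k, of u]) (use u eq harmonic_nonneg[OF g(1)] in auto)
  ultimately show "g = k" by simp
qed

lemma extreme_harm_theta:
  assumes f: "harm f" "f 0 0 = 1"
    and ext: "extreme_harmonic (\<lambda>h t. 1) (\<lambda>h t. a (h + t)) f"
  shows "\<exists>\<theta>. f = theta_harm \<theta>"
proof -
  obtain y where y: "0 \<le> y" "y \<le> 1" and eq: "\<And>h t. (1 - y) * f (Suc h) t = y * f h (Suc t)"
    using extreme_harm_ratio[OF assms] by blast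
  show ?thesis
  proof (cases "y = 1")
    case True
    then have "f = all_heads_harm" using all_heads_harm_unique[OF f] eq by simp
    then show ?thesis by (intro exI[of _ \<infinity>]) (simp add: theta_harm_def)
  next
    case False
    then have y1: "0 < 1 - y" using y by simp
    let ?\<theta> = "y / (1 - y)"
    have \<theta>: "0 \<le> ?\<theta>" using y y1 by simp
    have "f (Suc h) t = ?\<theta> * f h (Suc t)" for h t
      using eq[of h t] y1 by (simp add: field_simps)
    then have "f = indep_harm ?\<theta>" by (rule indep_harm_unique[OF \<theta> f])
    then show ?thesis using \<theta> by (intro exI[of _ "ennreal ?\<theta>"]) (simp add: theta_harm_def)
  qed
qed

lemma P_theta_represented:
  "represents (\<lambda>h t. 1) (\<lambda>h t. a (h + t)) (P_theta a \<theta>) (theta_harm \<theta>)"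
proof -
  consider "\<theta> = 0" | "\<theta> = \<infinity>" | "\<theta> \<noteq> 0" "\<theta> \<noteq> \<infinity>" by blast
  then show ?thesis
  proof cases
    case 1
    have "represents (\<lambda>h t. 1) (\<lambda>h t. a (h + t)) (return path_space (\<lambda>n. (0, n))) (indep_harm 0)"
    proof (rule represents_return)
      show "(\<lambda>n. (0, n)) \<in> infinite_paths" by (simp add: infinite_paths_def lattice_edge_def)
      show "indep_harm 0 (fst v) (snd v) = 0" if "v \<noteq> (0, fst v + snd v)" for v
      proof -
        have "fst v \<noteq> 0" using that by (cases v) auto
        then show ?thesis by (simp add: indep_harm_def)
      qed
    qed (simp_all add: harm_indep_harm indep_harm_0)
    then show ?thesis by (simp add: 1 P_theta_def theta_harm_def)
  next
    case 2
    have "represents (\<lambda>h t. 1) (\<lambda>h t. a (h + t)) (return path_space (\<lambda>n. (n, 0))) all_heads_harm"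
    proof (rule represents_return)
      show "(\<lambda>n. (n, 0)) \<in> infinite_paths" by (simp add: infinite_paths_def lattice_edge_def)
      show "all_heads_harm (fst v) (snd v) = 0" if "v \<noteq> (fst v + snd v, 0)" for v
      proof -
        have "snd v \<noteq> 0" using that by (cases v) auto
        then show ?thesis by (simp add: all_heads_harm_def)
      qed
    qed (simp_all add: harm_all_heads_harm all_heads_harm_def)
    then show ?thesis by (simp add: 2 P_theta_def theta_harm_def)
  next
    case 3
    then have "0 < enn2real \<theta>" by (simp add: enn2real_positive_iff top.not_eq_extremum zero_less_iff_neq_zero)
    then show ?thesis using 3 indep_law_represented by (simp add: P_theta_def theta_harm_def)
  qed
qed

lemma extreme_laws_eq:
  "extreme_laws (path_laws (\<lambda>h t. 1) (\<lambda>h t. a (h + t))) = range (P_theta a)"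
proof (intro set_eqI iffI)
  fix P assume P: "P \<in> extreme_laws (path_laws (\<lambda>h t. 1) (\<lambda>h t. a (h + t)))"
  then have "P \<in> path_laws (\<lambda>h t. 1) (\<lambda>h t. a (h + t))" by (simp add: extreme_laws_def)
  then obtain f where f: "represents (\<lambda>h t. 1) (\<lambda>h t. a (h + t)) P f"
    using law_represented by blast
  have "\<exists>\<theta>. f = theta_harm \<theta>"
    using extreme_law_iff[OF f] P by (intro extreme_harm_theta represents_harmonic[OF f]) simp
  then show "P \<in> range (P_theta a)"
    using represents_unique[OF f] P_theta_represented by blast
next
  fix P assume "P \<in> range (P_theta a)"
  then obtain \<theta> where P: "P = P_theta a \<theta>" by blast
  show "P \<in> extreme_laws (path_laws (\<lambda>h t. 1) (\<lambda>h t. a (h + t)))"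
    unfolding P extreme_law_iff[OF P_theta_represented] by (rule theta_harm_extreme)
qed

lemma first_step_P_theta:
  "first_step_prob (P_theta a \<theta>) = (if \<theta> = \<infinity> then 1 else enn2real \<theta> / (a 0 + enn2real \<theta>))"
  using represents_first_step[OF P_theta_represented, of \<theta>]
  by (simp add: theta_harm_def all_heads_harm_def indep_harm_def add.commute)

end

theorem proposition7:
  fixes a :: "nat \<Rightarrow> real"
  assumes "\<And>n. 0 < a n"
    and "(\<Sum>n. ennreal (a n / (1 + a n)\<^sup>2)) = \<infinity>"
  shows "extreme_laws (path_laws (\<lambda>h t. 1) (\<lambda>h t. a (h + t))) = range (P_theta a) \<and>
    first_step_prob ` extreme_laws (path_laws (\<lambda>h t. 1) (\<lambda>h t. a (h + t))) = {0..1} \<and>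
    range (\<lambda>\<theta>. first_step_prob (P_theta a \<theta>)) = {0..1} \<and>
    (\<forall>\<theta>::real. 0 \<le> \<theta> \<longrightarrow> first_step_prob (P_theta a (ennreal \<theta>)) = \<theta> / (a 0 + \<theta>)) \<and>
    first_step_prob (P_theta a \<infinity>) = 1"
proof -
  interpret positive_sequence a by unfold_locales (rule assms(1))
  have "\<forall>k. \<exists>n. real k + 1 \<le> var_mass {k..<n}" using var_mass_unbounded[OF assms(2)] by blast
  then obtain N where "\<And>k. real k + 1 \<le> var_mass {k..<N k}" by metis
  then interpret divergent_sequence a N by unfold_locales
  have range: "range (\<lambda>\<theta>. first_step_prob (P_theta a \<theta>)) = {0..1}"
  proof (intro set_eqI iffI)
    fix x assume "x \<in> range (\<lambda>\<theta>. first_step_prob (P_theta a \<theta>))"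
    then obtain \<theta> where x: "x = first_step_prob (P_theta a \<theta>)" by blast
    have "0 < a 0 + enn2real \<theta>" using a_pos[of 0] enn2real_nonneg[of \<theta>] by linarith
    then show "x \<in> {0..1}"
      using less_imp_le[OF a_pos[of 0]] by (simp add: x first_step_P_theta)
  next
    fix x :: real assume x: "x \<in> {0..1}"
    show "x \<in> range (\<lambda>\<theta>. first_step_prob (P_theta a \<theta>))"
    proof (cases "x = 1")
      case True
      then show ?thesis by (intro range_eqI[of _ _ \<infinity>]) (simp add: first_step_P_theta)
    next
      case False
      \<comment> \<open>The solution of \<open>x = \<theta> / (a 0 + \<theta>)\<close> for
        \<open>x < 1\<close>.\<close>
      let ?\<theta> = "a 0 * x / (1 - x)"
      have x1: "0 < 1 - x" using x False by simp
      have \<theta>: "0 \<le> ?\<theta>" using x x1 a_pos[of 0] by simp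
      have "a 0 + ?\<theta> = a 0 / (1 - x)" using x1 by (simp add: field_simps)
      then have "?\<theta> / (a 0 + ?\<theta>) = x" using x1 a_pos[of 0] by simp
      then show ?thesis
        using \<theta> by (intro range_eqI[of _ _ "ennreal ?\<theta>"]) (simp add: first_step_P_theta)
    qed
  qed
  then show ?thesis
    unfolding extreme_laws_eq by (simp add: image_image first_step_P_theta)
qed

end
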